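(* Let $\Lambda_{0,0}$ be a smooth (non-tubular) linear Weingarten surface, and let $\{\Lambda_{m,n}=f^+_{m,n}\oplus f^-_{m,n}\}_{m,n\ge0}$ be a lattice of Lie-Darboux transforms of $\Lambda_{0,0}$ keeping the linear Weingarten condition (as defined in the context). Then for every $x\in\Sigma^2$ the discrete map $(m,n)\mapsto\Lambda_{m,n}(x)$ is a discrete linear Weingarten surface; that is, discrete linear Weingarten surfaces are obtained as Bianchi quadrilaterals of Lie-Darboux transformations keeping the linear Weingarten condition.
   Context: Ambient space. $\mathbb{R}^{4,2}$ carries the metric $(\cdot,\cdot)$ of signature $(4,2)$ with light cone $\mathcal{L}$; $\mathbb{P}(\mathcal{L})$ is the Lie quadric and $Z$ is the set of lines in it (null $2$-planes of $\mathbb{R}^{4,2}$). $\Sigma^2$ is a simply connected surface; maps $f:\Sigma^2\to\mathbb{P}(\mathcal{L})$ are viewed as null line subbundles and maps $\Lambda:\Sigma^2\to Z$ as rank $2$ null subbundles of $\Sigma^2\times\mathbb{R}^{4,2}$. We identify $\wedge^2\mathbb{R}^{4,2}\cong\mathfrak{o}(4,2)$ via $(u\wedge v)w=(u,w)v-(v,w)u$. For non-orthogonal null lines $a,b$ and $s\in\mathbb{R}\setminus\{0\}$, $\Gamma_a^b(s)$ is the orthogonal map acting as $s$ on $b$, $s^{-1}$ on $a$, and the identity on $(a\oplus b)^\perp$. Isothermic maps. $f:\Sigma^2\to\mathbb{P}(\mathcal{L})$ is isothermic (an isothermic sphere congruence), with associated form $\eta$, if $\eta\in\Omega^1(f\wedge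 f^\perp)$ is closed and nowhere zero; its connections $\Gamma(t)=d+t\eta$ are flat. A Darboux transform of $f$ with parameter $\mu\in\mathbb{R}\setminus\{0\}$ is a map $\hat f$, nowhere orthogonal to $f$, whose line bundle is $\Gamma(\mu)$-parallel; it is isothermic with connections $\hat\Gamma(t)=\Gamma_f^{\hat f}(1-\tfrac t\mu)\circ\Gamma(t)\circ\Gamma_f^{\hat f}(1-\tfrac t\mu)^{-1}$. If $f_j,f_\ell$ are Darboux transforms of $f_i$ with parameters $m_{ij}\ne m_{i\ell}$, Bianchi permutability gives $f_k=\Gamma_{f_i}^{f_j}(1-\tfrac{m_{i\ell}}{m_{ij}})f_\ell=\Gamma_{f_i}^{f_\ell}(1-\tfrac{m_{ij}}{m_{i\ell}})f_j$, simultaneously a Darboux transform of $f_j$ with parameter $m_{i\ell}$ and of $f_\ell$ with parameter $m_{ij}$. A constant conserved quantity of $f$ is a nonzero constant vector $c\in\mathbb{R}^{4,2}$ with $\Gamma(t)c=0$ for all $t$. $\Omega$-surfaces. Isothermic maps $f^+,f^-$ form an isotropic Darboux pair if there is a section $\tau$ of $f^+\wedge f^-$ with $\Gamma^-(t)=\exp(t\tau)\circ\Gamma^+(t)\circ\exp(-t\tau)$ for all $t$. An $\Omega$-surface is a Legendre immersion $\Lambda=f^+\oplus f^-:\Sigma^2\to Z$ spanned by an isotropic Darboux pair. If $\hat f^+$ is a Darboux transform of $f^+$ with parameter $\mu$, there is a unique $\hat f^-$, namely $\hat f^-=\exp(\mu\tau)\hat f^+$, that is a Darboux transform of $f^-$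 with parameter $\mu$ and forms an isotropic Darboux pair with $\hat f^+$; $\hat\Lambda=\hat f^+\oplus\hat f^-$ is a Lie-Darboux transform of $\Lambda$ with parameter $\mu$. Linear Weingarten surfaces. Non-tubular linear Weingarten surfaces in space forms (surfaces satisfying an affine linear relation between Gauss and mean curvatures) are characterized as the $\Omega$-surfaces $\Lambda=f^+\oplus f^-$ for which both $f^+$ and $f^-$ admit constant conserved quantities, denoted $c^+$ and $c^-$ respectively. A Lie-Darboux transform $\hat\Lambda=\hat f^+\oplus\hat f^-$ keeps the linear Weingarten condition if it is of B\"acklund type for both sphere congruences, i.e. $c^+\perp\hat f^+$ and $c^-\perp\hat f^-$; then $c^\pm$ is a constant conserved quantity of $\hat f^\pm$. Lattice. $\Lambda_{m+1,0}$ is a Lie-Darboux transform of $\Lambda_{m,0}$ keeping the linear Weingarten condition, with parameter $\alpha_m$; $\Lambda_{0,n+1}$ is one of $\Lambda_{0,n}$ with parameter $\beta_n$ (all with respect to the same $c^\pm$); $\alpha_m\ne\beta_n$; and all other $f^\pm_{m,n}$ are determined by Bianchi permutability on elementary quadrilaterals, separately for the $+$ and the $-$ maps. All maps are assumed nondegenerate as needed, in particular $f^\pm_{m,n}$ is nowhere orthogonal to its lattice neighbours of the same sign. Discrete surfaces. Write $i=(m,n)$, $j=(m+1,n)$, $k=(m+1,n+1)$, $\ell=(m,n+1)$. A discrete map $F$ into $\mathbb{P}(\mathcal{L})$ with adjacent values non-orthogonal is discrete isothermic if there is a real non-vanishing edge-labeling with $m_{ij}=m_{\ell k}$, $m_{i\ell}=m_{jk}$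 such that $\Gamma(t)_{ji}:=\Gamma_{F_i}^{F_j}(1-\tfrac t{m_{ij}})$ satisfies $\Gamma(t)_{kj}\Gamma(t)_{ji}=\Gamma(t)_{k\ell}\Gamma(t)_{\ell i}$ for all $t$ (where defined). Discrete isothermic maps $F^\pm$ with the same edge-labeling form a (discrete) isotropic Darboux pair if there are $\tau_i\in F^+_i\wedge F^-_i$ with $\Gamma^-(t)_{ji}=\exp(t\tau_j)\,\Gamma^+(t)_{ji}\,\exp(-t\tau_i)$ on all edges and all $t$ (where defined). A discrete $\Omega$-surface is a map $i\mapsto F^+_i\oplus F^-_i\in Z$ spanned by a discrete isotropic Darboux pair. It is a discrete linear Weingarten surface if both $F^+$ and $F^-$ admit constant conserved quantities, i.e. there are nonzero $c^\pm\in\mathbb{R}^{4,2}$ with $\Gamma^\pm(t)_{ji}c^\pm=c^\pm$ on all edges for all $t$ (where defined). *)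

theory Defs
  imports "HOL-Analysis.Analysis"
begin

section \<open>Lie sphere geometry\<close>

type_synonym r42 = "(real^4) \<times> (real^2)"

definition lip :: "r42 \<Rightarrow> r42 \<Rightarrow> real" where
  "lip u v = fst u \<bullet> fst v - snd u \<bullet> snd v"

text \<open>Points of the projectivised light cone are the null lines, as subsets of the vector
  space; elements of Z are the null planes.\<close>

definition null_line :: "r42 set \<Rightarrow> bool" where
  "null_line a \<longleftrightarrow> (\<exists>v. v \<noteq> 0 \<and> lip v v = 0 \<and> a = span {v})"

definition null_plane :: "r42 set \<Rightarrow> bool" where
  "null_plane L \<longleftrightarrow> subspace L \<and> dim L = 2 \<and> (\<forall>u\<in>L. \<forall>v\<in>L. lip u v = 0)"

definition orth :: "r42 set \<Rightarrow> r42 set \<Rightarrow> bool" where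
  "orth a b \<longleftrightarrow> (\<forall>u\<in>a. \<forall>v\<in>b. lip u v = 0)"

definition perp :: "r42 set \<Rightarrow> r42 set" where
  "perp a = {w. \<forall>u\<in>a. lip u w = 0}"

definition lsum :: "r42 set \<Rightarrow> r42 set \<Rightarrow> r42 set" where
  "lsum a b = {u + v | u v. u \<in> a \<and> v \<in> b}"

definition wedge :: "r42 \<Rightarrow> r42 \<Rightarrow> r42 \<Rightarrow> r42" where
  "wedge u v = (\<lambda>w. lip u w *\<^sub>R v - lip v w *\<^sub>R u)"

text \<open>Only used when \<open>a\<close> is a line; every element of the wedge product of \<open>a\<close> and \<open>b\<close> is then
  decomposable, so no linear span is needed.\<close>

definition wedge_set :: "r42 set \<Rightarrow> r42 set \<Rightarrow> (r42 \<Rightarrow> r42) set" where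
  "wedge_set a b = {wedge u v | u v. u \<in> a \<and> v \<in> b}"

definition op_exp :: "(r42 \<Rightarrow> r42) \<Rightarrow> r42 \<Rightarrow> r42" where
  "op_exp T w = (\<Sum>k. (1 / fact k) *\<^sub>R (T ^^ k) w)"

definition exp_tau :: "real \<Rightarrow> (r42 \<Rightarrow> r42) \<Rightarrow> r42 \<Rightarrow> r42" where
  "exp_tau t T = op_exp (\<lambda>w. t *\<^sub>R T w)"

text \<open>The defining properties determine the map uniquely if \<open>a\<close> and \<open>b\<close> are
  non-orthogonal null lines and \<open>s\<close> is non-zero.\<close>

definition Gam :: "r42 set \<Rightarrow> r42 set \<Rightarrow> real \<Rightarrow> r42 \<Rightarrow> r42" where
  "Gam a b s = (THE T. linear T \<and> (\<forall>v\<in>b. T v = s *\<^sub>R v) \<and> (\<forall>u\<in>a. T u = (1 / s) *\<^sub>R u) \<and>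
     (\<forall>w\<in>perp (lsum a b). T w = w))"


section \<open>Smooth surfaces\<close>

primrec Ck_on :: "nat \<Rightarrow> (real^2) set \<Rightarrow> (real^2 \<Rightarrow> 'b::real_normed_vector) \<Rightarrow> bool" where
  "Ck_on 0 S g = continuous_on S g"
| "Ck_on (Suc k) S g = ((\<forall>y\<in>S. g differentiable (at y)) \<and>
     (\<forall>v. Ck_on k S (\<lambda>y. frechet_derivative g (at y) v)))"

definition smooth_on :: "(real^2) set \<Rightarrow> (real^2 \<Rightarrow> 'b::real_normed_vector) \<Rightarrow> bool" where
  "smooth_on S g \<longleftrightarrow> (\<forall>k. Ck_on k S g)"

text \<open>The surface is the whole type \<open>'p\<close>. A chart \<open>(W, \<psi>)\<close> is a local parametrization
  \<open>\<psi>\<close> on the open set \<open>W\<close> of the plane; a tangent vector at \<open>\<psi> y\<close> is given by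
  \<open>(W, \<psi>)\<close>, \<open>y\<close> and its coordinate vector.\<close>

type_synonym 'p chart = "(real^2) set \<times> (real^2 \<Rightarrow> 'p)"

definition smooth_surface :: "('p::{t2_space,second_countable_topology}) chart set \<Rightarrow> bool" where
  "smooth_surface A \<longleftrightarrow>
     (\<forall>(W, \<psi>)\<in>A. open W \<and> inj_on \<psi> W \<and> continuous_on W \<psi> \<and>
        (\<forall>V\<subseteq>W. open V \<longrightarrow> open (\<psi> ` V))) \<and>
     (\<Union>(W, \<psi>)\<in>A. \<psi> ` W) = UNIV \<and>
     (\<forall>(W, \<psi>)\<in>A. \<forall>(W', \<psi>')\<in>A.
        smooth_on {y\<in>W. \<psi> y \<in> \<psi>' ` W'} (the_inv_into W' \<psi>' \<circ> \<psi>))"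

definition smooth_map :: "('p::topological_space) chart set \<Rightarrow> 'p set \<Rightarrow>
    ('p \<Rightarrow> 'b::real_normed_vector) \<Rightarrow> bool" where
  "smooth_map A U s \<longleftrightarrow> (\<forall>(W, \<psi>)\<in>A. smooth_on {y\<in>W. \<psi> y \<in> U} (s \<circ> \<psi>))"

definition deriv_along :: "('p \<Rightarrow> 'b::real_normed_vector) \<Rightarrow> 'p chart \<Rightarrow> real^2 \<Rightarrow> real^2 \<Rightarrow> 'b" where
  "deriv_along s c y a = frechet_derivative (s \<circ> snd c) (at y) a"

definition smooth_section :: "('p::topological_space) chart set \<Rightarrow> 'p set \<Rightarrow> ('p \<Rightarrow> r42 set) \<Rightarrow>
    ('p \<Rightarrow> r42) \<Rightarrow> bool" where
  "smooth_section A U L s \<longleftrightarrow> open U \<and> smooth_map A U s \<and> (\<forall>p\<in>U. s p \<in> L p)"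

text \<open>Smooth maps into the Lie quadric, as null line subbundles of the trivial bundle.\<close>

definition null_line_bundle :: "('p::topological_space) chart set \<Rightarrow> ('p \<Rightarrow> r42 set) \<Rightarrow> bool" where
  "null_line_bundle A f \<longleftrightarrow> (\<forall>p. null_line (f p)) \<and>
     (\<forall>p. \<exists>U s. p \<in> U \<and> smooth_section A U f s \<and> (\<forall>q\<in>U. f q = span {s q}))"

text \<open>Operator-valued 1-forms, given by their values in every chart.\<close>

type_synonym 'p form = "'p chart \<Rightarrow> real^2 \<Rightarrow> real^2 \<Rightarrow> r42 \<Rightarrow> r42"

definition one_form :: "('p::topological_space) chart set \<Rightarrow> 'p form \<Rightarrow> bool" where
  "one_form A \<eta> \<longleftrightarrow>
     (\<forall>(W, \<psi>)\<in>A. \<forall>y\<in>W. \<forall>a w. linear (\<lambda>a. \<eta> (W, \<psi>) y a w) \<and> linear (\<eta> (W, \<psi>) y a)) \<and>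
     (\<forall>(W, \<psi>)\<in>A. \<forall>a w. smooth_on W (\<lambda>y. \<eta> (W, \<psi>) y a w)) \<and>
     (\<forall>(W, \<psi>)\<in>A. \<forall>(W', \<psi>')\<in>A. \<forall>y\<in>W. \<forall>y'\<in>W'. \<psi> y = \<psi>' y' \<longrightarrow>
        (\<forall>a. \<eta> (W, \<psi>) y a =
          \<eta> (W', \<psi>') y' (frechet_derivative (the_inv_into W' \<psi>' \<circ> \<psi>) (at y) a)))"

definition closed_form :: "'p chart set \<Rightarrow> 'p form \<Rightarrow> bool" where
  "closed_form A \<eta> \<longleftrightarrow> (\<forall>(W, \<psi>)\<in>A. \<forall>y\<in>W. \<forall>a b w.
     frechet_derivative (\<lambda>z. \<eta> (W, \<psi>) z b w) (at y) a =
     frechet_derivative (\<lambda>z. \<eta> (W, \<psi>) z a w) (at y) b)"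


section \<open>Isothermic maps and their transformations\<close>

text \<open>An isothermic map is represented by the pair of \<open>f\<close> and its associated form \<open>\<eta>\<close>.\<close>

definition isothermic :: "('p::topological_space) chart set \<Rightarrow> ('p \<Rightarrow> r42 set) \<Rightarrow> 'p form \<Rightarrow> bool" where
  "isothermic A f \<eta> \<longleftrightarrow> null_line_bundle A f \<and> one_form A \<eta> \<and>
     (\<forall>(W, \<psi>)\<in>A. \<forall>y\<in>W. \<forall>a. \<eta> (W, \<psi>) y a \<in> wedge_set (f (\<psi> y)) (perp (f (\<psi> y)))) \<and>
     closed_form A \<eta> \<and>
     (\<forall>(W, \<psi>)\<in>A. \<forall>y\<in>W. \<exists>a w. \<eta> (W, \<psi>) y a w \<noteq> 0)"

text \<open>The connection \<open>d + t \<eta>\<close>, applied to the section \<open>s\<close>.\<close>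

definition conn :: "'p form \<Rightarrow> real \<Rightarrow> ('p \<Rightarrow> r42) \<Rightarrow> 'p chart \<Rightarrow> real^2 \<Rightarrow> real^2 \<Rightarrow> r42" where
  "conn \<eta> t s c y a = deriv_along s c y a + t *\<^sub>R \<eta> c y a (s (snd c y))"

text \<open>The connection of \<open>\<eta>'\<close> at \<open>t\<close> equals \<open>g \<circ> (d + t \<eta>) \<circ> h\<close>, as operators on sections.\<close>

definition conn_conj :: "('p::topological_space) chart set \<Rightarrow> real \<Rightarrow> 'p form \<Rightarrow>
    ('p \<Rightarrow> r42 \<Rightarrow> r42) \<Rightarrow> 'p form \<Rightarrow> ('p \<Rightarrow> r42 \<Rightarrow> r42) \<Rightarrow> bool" where
  "conn_conj A t \<eta>' g \<eta> h \<longleftrightarrow> (\<forall>s. smooth_map A UNIV s \<longrightarrow>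
     (\<forall>(W, \<psi>)\<in>A. \<forall>y\<in>W. \<forall>a.
        conn \<eta>' t s (W, \<psi>) y a = g (\<psi> y) (conn \<eta> t (\<lambda>p. h p (s p)) (W, \<psi>) y a)))"

text \<open>The connections of \<open>f'\<close> are gauge equivalent to those of \<open>f\<close> where the gauge
  transformation is defined, that is, for \<open>t \<noteq> \<mu>\<close>.\<close>

definition darboux_transform :: "('p::topological_space) chart set \<Rightarrow> real \<Rightarrow>
    ('p \<Rightarrow> r42 set) \<Rightarrow> 'p form \<Rightarrow> ('p \<Rightarrow> r42 set) \<Rightarrow> 'p form \<Rightarrow> bool" where
  "darboux_transform A \<mu> f \<eta> f' \<eta>' \<longleftrightarrow>
     \<mu> \<noteq> 0 \<and> isothermic A f \<eta> \<and> isothermic A f' \<eta>' \<and>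
     (\<forall>p. \<not> orth (f p) (f' p)) \<and>
     (\<forall>U s. smooth_section A U f' s \<longrightarrow>
        (\<forall>(W, \<psi>)\<in>A. \<forall>y\<in>W. \<psi> y \<in> U \<longrightarrow> (\<forall>a. conn \<eta> \<mu> s (W, \<psi>) y a \<in> f' (\<psi> y)))) \<and>
     (\<forall>t. t \<noteq> \<mu> \<longrightarrow> conn_conj A t \<eta>' (\<lambda>p. Gam (f p) (f' p) (1 - t / \<mu>))
                              \<eta> (\<lambda>p. inv (Gam (f p) (f' p) (1 - t / \<mu>))))"

definition const_conserved :: "'p chart set \<Rightarrow> 'p form \<Rightarrow> r42 \<Rightarrow> bool" where
  "const_conserved A \<eta> c \<longleftrightarrow> c \<noteq> 0 \<and>
     (\<forall>t. \<forall>(W, \<psi>)\<in>A. \<forall>y\<in>W. \<forall>a. conn \<eta> t (\<lambda>_. c) (W, \<psi>) y a = 0)"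

definition isotropic_darboux :: "('p::topological_space) chart set \<Rightarrow> ('p \<Rightarrow> r42 set) \<Rightarrow> 'p form \<Rightarrow>
    ('p \<Rightarrow> r42 set) \<Rightarrow> 'p form \<Rightarrow> ('p \<Rightarrow> r42 \<Rightarrow> r42) \<Rightarrow> bool" where
  "isotropic_darboux A fp \<eta>p fm \<eta>m \<tau> \<longleftrightarrow>
     isothermic A fp \<eta>p \<and> isothermic A fm \<eta>m \<and>
     (\<forall>p. \<tau> p \<in> wedge_set (fp p) (fm p)) \<and> (\<forall>w. smooth_map A UNIV (\<lambda>p. \<tau> p w)) \<and>
     (\<forall>t. conn_conj A t \<eta>m (\<lambda>p. exp_tau t (\<tau> p)) \<eta>p (\<lambda>p. exp_tau (- t) (\<tau> p)))"

text \<open>Smooth null plane bundle; contact condition; injectivity of the differential, which at a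
  point is the map sending a tangent vector to the derivative of sections modulo \<open>L\<close>.\<close>

definition legendre_immersion :: "('p::topological_space) chart set \<Rightarrow> ('p \<Rightarrow> r42 set) \<Rightarrow> bool" where
  "legendre_immersion A L \<longleftrightarrow>
     (\<forall>p. null_plane (L p)) \<and>
     (\<forall>p. \<exists>U s1 s2. p \<in> U \<and> smooth_section A U L s1 \<and> smooth_section A U L s2 \<and>
        (\<forall>q\<in>U. L q = span {s1 q, s2 q})) \<and>
     (\<forall>U s1 s2. smooth_section A U L s1 \<and> smooth_section A U L s2 \<longrightarrow>
        (\<forall>(W, \<psi>)\<in>A. \<forall>y\<in>W. \<psi> y \<in> U \<longrightarrow>
          (\<forall>a. lip (deriv_along s1 (W, \<psi>) y a) (s2 (\<psi> y)) = 0))) \<and>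
     (\<forall>(W, \<psi>)\<in>A. \<forall>y\<in>W. \<forall>a.
        (\<forall>U s. smooth_section A U L s \<and> \<psi> y \<in> U \<longrightarrow> deriv_along s (W, \<psi>) y a \<in> L (\<psi> y))
        \<longrightarrow> a = 0)"

definition omega_surface :: "('p::topological_space) chart set \<Rightarrow> ('p \<Rightarrow> r42 set) \<Rightarrow> 'p form \<Rightarrow>
    ('p \<Rightarrow> r42 set) \<Rightarrow> 'p form \<Rightarrow> bool" where
  "omega_surface A fp \<eta>p fm \<eta>m \<longleftrightarrow>
     (\<exists>\<tau>. isotropic_darboux A fp \<eta>p fm \<eta>m \<tau>) \<and>
     legendre_immersion A (\<lambda>p. lsum (fp p) (fm p))"

text \<open>Non-tubular linear Weingarten surfaces, through their characterization as Omega surfaces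
  whose two isothermic sphere congruences admit constant conserved quantities.\<close>

definition linear_weingarten :: "('p::topological_space) chart set \<Rightarrow> ('p \<Rightarrow> r42 set) \<Rightarrow> 'p form \<Rightarrow>
    ('p \<Rightarrow> r42 set) \<Rightarrow> 'p form \<Rightarrow> r42 \<Rightarrow> r42 \<Rightarrow> bool" where
  "linear_weingarten A fp \<eta>p fm \<eta>m cp cm \<longleftrightarrow>
     omega_surface A fp \<eta>p fm \<eta>m \<and> const_conserved A \<eta>p cp \<and> const_conserved A \<eta>m cm"

definition lie_darboux :: "('p::topological_space) chart set \<Rightarrow> real \<Rightarrow>
    ('p \<Rightarrow> r42 set) \<Rightarrow> 'p form \<Rightarrow> ('p \<Rightarrow> r42 set) \<Rightarrow> 'p form \<Rightarrow>
    ('p \<Rightarrow> r42 set) \<Rightarrow> 'p form \<Rightarrow> ('p \<Rightarrow> r42 set) \<Rightarrow> 'p form \<Rightarrow> bool" where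
  "lie_darboux A \<mu> fp \<eta>p fm \<eta>m fp' \<eta>p' fm' \<eta>m' \<longleftrightarrow>
     omega_surface A fp \<eta>p fm \<eta>m \<and>
     darboux_transform A \<mu> fp \<eta>p fp' \<eta>p' \<and> darboux_transform A \<mu> fm \<eta>m fm' \<eta>m' \<and>
     (\<exists>\<tau>'. isotropic_darboux A fp' \<eta>p' fm' \<eta>m' \<tau>') \<and>
     (\<exists>\<tau>. isotropic_darboux A fp \<eta>p fm \<eta>m \<tau> \<and> (\<forall>p. fm' p = exp_tau \<mu> (\<tau> p) ` fp' p))"

text \<open>Lie-Darboux transforms of Baecklund type for both sphere congruences.\<close>

definition lie_darboux_keeping_lw :: "('p::topological_space) chart set \<Rightarrow> r42 \<Rightarrow> r42 \<Rightarrow> real \<Rightarrow>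
    ('p \<Rightarrow> r42 set) \<Rightarrow> 'p form \<Rightarrow> ('p \<Rightarrow> r42 set) \<Rightarrow> 'p form \<Rightarrow>
    ('p \<Rightarrow> r42 set) \<Rightarrow> 'p form \<Rightarrow> ('p \<Rightarrow> r42 set) \<Rightarrow> 'p form \<Rightarrow> bool" where
  "lie_darboux_keeping_lw A cp cm \<mu> fp \<eta>p fm \<eta>m fp' \<eta>p' fm' \<eta>m' \<longleftrightarrow>
     lie_darboux A \<mu> fp \<eta>p fm \<eta>m fp' \<eta>p' fm' \<eta>m' \<and>
     (\<forall>p. cp \<in> perp (fp' p)) \<and> (\<forall>p. cm \<in> perp (fm' p))"

text \<open>Bianchi permutability on all elementary quadrilaterals, with parameter \<open>\<alpha> m\<close> on the edges
  from \<open>(m, n)\<close> to \<open>(m + 1, n)\<close> and \<open>\<beta> n\<close> on those from \<open>(m, n)\<close> to \<open>(m, n + 1)\<close>, together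
  with the nondegeneracy of neighbouring maps.\<close>

definition bianchi_lattice :: "(nat \<Rightarrow> real) \<Rightarrow> (nat \<Rightarrow> real) \<Rightarrow> (nat \<Rightarrow> nat \<Rightarrow> 'p \<Rightarrow> r42 set) \<Rightarrow> bool" where
  "bianchi_lattice \<alpha> \<beta> f \<longleftrightarrow> (\<forall>m n x.
     \<not> orth (f m n x) (f (Suc m) n x) \<and> \<not> orth (f m n x) (f m (Suc n) x) \<and>
     f (Suc m) (Suc n) x = Gam (f m n x) (f (Suc m) n x) (1 - \<beta> n / \<alpha> m) ` f m (Suc n) x \<and>
     f (Suc m) (Suc n) x = Gam (f m n x) (f m (Suc n) x) (1 - \<alpha> m / \<beta> n) ` f (Suc m) n x)"


section \<open>Discrete surfaces\<close>

type_synonym vertex = "nat \<times> nat"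

definition adj :: "vertex \<Rightarrow> vertex \<Rightarrow> bool" where
  "adj i j \<longleftrightarrow> (\<exists>m n. {i, j} = {(m, n), (Suc m, n)} \<or> {i, j} = {(m, n), (m, Suc n)})"

definition edge_labeling :: "(vertex \<Rightarrow> vertex \<Rightarrow> real) \<Rightarrow> bool" where
  "edge_labeling lab \<longleftrightarrow>
     (\<forall>i j. adj i j \<longrightarrow> lab i j \<noteq> 0 \<and> lab i j = lab j i) \<and>
     (\<forall>m n. lab (m, n) (Suc m, n) = lab (m, Suc n) (Suc m, Suc n) \<and>
            lab (m, n) (m, Suc n) = lab (Suc m, n) (Suc m, Suc n))"

text \<open>\<open>dconn F lab t j i\<close> is the map \<open>\<Gamma>(t)\<^sub>j\<^sub>i\<close> from the vertex \<open>i\<close> to the vertex \<open>j\<close>; it is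
  defined for \<open>t \<noteq> lab i j\<close>.\<close>

definition dconn :: "(vertex \<Rightarrow> r42 set) \<Rightarrow> (vertex \<Rightarrow> vertex \<Rightarrow> real) \<Rightarrow> real \<Rightarrow>
    vertex \<Rightarrow> vertex \<Rightarrow> r42 \<Rightarrow> r42" where
  "dconn F lab t j i = Gam (F i) (F j) (1 - t / lab i j)"

definition discrete_isothermic :: "(vertex \<Rightarrow> r42 set) \<Rightarrow> (vertex \<Rightarrow> vertex \<Rightarrow> real) \<Rightarrow> bool" where
  "discrete_isothermic F lab \<longleftrightarrow>
     (\<forall>i. null_line (F i)) \<and> (\<forall>i j. adj i j \<longrightarrow> \<not> orth (F i) (F j)) \<and>
     edge_labeling lab \<and>
     (\<forall>m n t. let i = (m, n); j = (Suc m, n); k = (Suc m, Suc n); l = (m, Suc n) in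
        t \<noteq> lab i j \<longrightarrow> t \<noteq> lab i l \<longrightarrow>
        dconn F lab t k j \<circ> dconn F lab t j i = dconn F lab t k l \<circ> dconn F lab t l i)"

definition discrete_isotropic_darboux :: "(vertex \<Rightarrow> r42 set) \<Rightarrow> (vertex \<Rightarrow> r42 set) \<Rightarrow>
    (vertex \<Rightarrow> vertex \<Rightarrow> real) \<Rightarrow> bool" where
  "discrete_isotropic_darboux Fp Fm lab \<longleftrightarrow>
     discrete_isothermic Fp lab \<and> discrete_isothermic Fm lab \<and>
     (\<exists>\<tau>. (\<forall>i. \<tau> i \<in> wedge_set (Fp i) (Fm i)) \<and>
        (\<forall>i j t. adj i j \<longrightarrow> t \<noteq> lab i j \<longrightarrow>
           dconn Fm lab t j i = exp_tau t (\<tau> j) \<circ> dconn Fp lab t j i \<circ> exp_tau (- t) (\<tau> i)))"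

definition discrete_omega_surface :: "(vertex \<Rightarrow> r42 set) \<Rightarrow> (vertex \<Rightarrow> r42 set) \<Rightarrow>
    (vertex \<Rightarrow> r42 set) \<Rightarrow> (vertex \<Rightarrow> vertex \<Rightarrow> real) \<Rightarrow> bool" where
  "discrete_omega_surface L Fp Fm lab \<longleftrightarrow> discrete_isotropic_darboux Fp Fm lab \<and>
     (\<forall>i. L i = lsum (Fp i) (Fm i) \<and> null_plane (L i))"

definition discrete_const_conserved :: "(vertex \<Rightarrow> r42 set) \<Rightarrow> (vertex \<Rightarrow> vertex \<Rightarrow> real) \<Rightarrow>
    r42 \<Rightarrow> bool" where
  "discrete_const_conserved F lab c \<longleftrightarrow> c \<noteq> 0 \<and>
     (\<forall>i j t. adj i j \<longrightarrow> t \<noteq> lab i j \<longrightarrow> dconn F lab t j i c = c)"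

definition discrete_linear_weingarten :: "(vertex \<Rightarrow> r42 set) \<Rightarrow> bool" where
  "discrete_linear_weingarten L \<longleftrightarrow> (\<exists>Fp Fm lab. discrete_omega_surface L Fp Fm lab \<and>
     (\<exists>cp. discrete_const_conserved Fp lab cp) \<and> (\<exists>cm. discrete_const_conserved Fm lab cm))"

end

theory Submission
  imports Defs
begin

text \<open>
  The problem is pointwise except on the two coordinate axes. At a vertex the data are two
  orthogonal null lines \<open>f\<^sup>\<plusminus>\<close> and an operator \<open>\<tau>\<close> in \<open>f\<^sup>+ \<and> f\<^sup>-\<close>. An edge with parameter \<open>\<mu>\<close> from \<open>i\<close>
  to \<open>j\<close> is good if \<open>f\<^sup>-\<^sub>j = exp(\<mu> \<tau>\<^sub>i) f\<^sup>+\<^sub>j\<close>. For such an edge there is an operator \<open>\<tau>\<^sub>j\<close> in \<open>f\<^sup>+\<^sub>j \<and> f\<^sup>-\<^sub>j\<close> for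
  which the gauge relation \<open>\<Gamma>\<^sup>-(t)\<^sub>j\<^sub>i = exp(t \<tau>\<^sub>j) \<Gamma>\<^sup>+(t)\<^sub>j\<^sub>i exp(- t \<tau>\<^sub>i)\<close> of a discrete isotropic Darboux
  pair holds (\<open>link_exists\<close>); this is linear algebra in the
  three-dimensional span of the four lines.

  Good edges propagate over elementary quadrilaterals (\<open>link_quadrilateral\<close>). In a Bianchi
  quadrilateral \<open>f\<^sub>k\<close> is the image of \<open>f\<^sub>l\<close> under \<open>\<Gamma>(m\<^sub>i\<^sub>l)\<^sub>j\<^sub>i\<close>, so the gauge relation at \<open>t = m\<^sub>i\<^sub>l\<close> carries the
  condition from the edge \<open>il\<close> to the edge \<open>jk\<close>. The operators at \<open>k\<close> reached through \<open>j\<close> and through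
  \<open>l\<close> agree because the products of the \<open>\<Gamma>\<close> along the two paths agree (\<open>Gam_permutability\<close>). Hence
  operators on the two axes with good edges extend uniquely to the lattice, and the discrete map is
  an Omega surface.

  On the axes the operators come from the smooth isotropic Darboux pairs. A Lie-Darboux
  transformation satisfies \<open>f\<^sup>-\<^sub>j = exp(\<mu> \<tau>\<^sub>i) f\<^sup>+\<^sub>j\<close> by definition. The remaining question is whether the
  operator \<open>\<tau>\<^sub>j\<close> produced by the algebra is the smooth one at the next vertex, from which the next
  transformation starts. The terms of first order in \<open>t\<close> of the various gauge relations show that
  both have the derivative \<open>\<eta>\<^sup>+\<^sub>j - \<eta>\<^sup>-\<^sub>j\<close>. Their difference is a section of \<open>f\<^sup>+\<^sub>j \<and> f\<^sup>-\<^sub>j\<close> with vanishing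
  derivative. If it were nonzero somewhere, the contact plane would be locally constant there, and
  the surface would not be immersed (\<open>legendre_parallel_wedge_vanishes\<close>, \<open>lie_darboux_link\<close>).

  For the conserved quantities, \<open>c\<^sup>\<plusminus>\<close> is orthogonal to \<open>f\<^sup>\<plusminus>\<close> at the origin, because it is
  annihilated by the form; on the axes, because the transformations are of Baecklund type; and then
  everywhere, because the fourth corner of a Bianchi quadrilateral lies in the span of the other
  three. A vector orthogonal to both lines of an edge is fixed by \<open>\<Gamma>(t)\<^sub>j\<^sub>i\<close>.
\<close>


section \<open>Boosts and null wedges\<close>

lemma lip_commute: "lip u v = lip v u"
  by (simp add: lip_def inner_commute)

lemma bounded_bilinear_lip: "bounded_bilinear lip"
proof -
  have "bounded_linear (\<lambda>v :: r42. (fst v, - snd v))"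
    by (intro bounded_linear_Pair bounded_linear_minus bounded_linear_fst bounded_linear_snd)
  then have "bounded_bilinear (\<lambda>u v :: r42. u \<bullet> (fst v, - snd v))"
    by (intro bounded_bilinear.comp[OF bounded_bilinear_inner bounded_linear_ident])
  moreover have "lip = (\<lambda>u v. u \<bullet> (fst v, - snd v))"
    by (intro ext) (simp add: lip_def inner_prod_def)
  ultimately show ?thesis by simp
qed

interpretation lip: bounded_bilinear lip
  by (rule bounded_bilinear_lip)

lemmas lip_simps = lip.add_left lip.add_right lip.diff_left lip.diff_right
  lip.scaleR_left lip.scaleR_right lip.zero_left lip.zero_right lip.minus_left lip.minus_right

text \<open>For null vectors \<open>u\<close>, \<open>v\<close> with nonzero product this is the map \<open>\<Gamma>\<close> of the lines that they span,
  as an explicit formula; it depends on \<open>u\<close> and \<open>v\<close> only through these lines.\<close>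

definition boost :: "r42 \<Rightarrow> r42 \<Rightarrow> real \<Rightarrow> r42 \<Rightarrow> r42" where
  "boost u v s w = w + ((s - 1) * lip u w / lip u v) *\<^sub>R v + ((1 / s - 1) * lip v w / lip u v) *\<^sub>R u"

lemma linear_boost: "linear (boost u v s)"
  by (rule linearI) (simp_all add: boost_def lip_simps algebra_simps add_divide_distrib diff_divide_distrib)

lemma Gam_span:
  assumes "lip u u = 0" "lip v v = 0" "lip u v \<noteq> 0" "s \<noteq> 0"
  shows "Gam (span {u}) (span {v}) s = boost u v s"
  unfolding Gam_def
proof (rule the_equality)
  have vu: "lip v u \<noteq> 0" using assms lip_commute by metis
  show "linear (boost u v s) \<and> (\<forall>x\<in>span {v}. boost u v s x = s *\<^sub>R x) \<and>
     (\<forall>x\<in>span {u}. boost u v s x = (1 / s) *\<^sub>R x) \<and>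
     (\<forall>w\<in>perp (lsum (span {u}) (span {v})). boost u v s w = w)"
  proof (intro conjI linear_boost ballI)
    fix x assume "x \<in> span {v}"
    then obtain k where "x = k *\<^sub>R v" by (auto simp: span_singleton)
    then show "boost u v s x = s *\<^sub>R x"
      using assms by (simp add: boost_def lip_simps algebra_simps diff_divide_distrib)
  next
    fix x assume "x \<in> span {u}"
    then obtain k where "x = k *\<^sub>R u" by (auto simp: span_singleton)
    then show "boost u v s x = (1 / s) *\<^sub>R x"
      using assms by (simp add: boost_def lip_simps lip_commute[of v u] algebra_simps
        diff_divide_distrib)
  next
    fix w assume w: "w \<in> perp (lsum (span {u}) (span {v}))"
    have "u + 0 \<in> lsum (span {u}) (span {v})" "0 + v \<in> lsum (span {u}) (span {v})"
      unfolding lsum_def by (blast intro: span_base span_zero)+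
    then show "boost u v s w = w" using w by (simp add: perp_def boost_def)
  qed
  fix T assume T: "linear T \<and> (\<forall>x\<in>span {v}. T x = s *\<^sub>R x) \<and>
     (\<forall>x\<in>span {u}. T x = (1 / s) *\<^sub>R x) \<and>
     (\<forall>w\<in>perp (lsum (span {u}) (span {v})). T w = w)"
  then interpret linear T by simp
  show "T = boost u v s"
  proof
    fix w
    define r where "r = w - (lip u w / lip u v) *\<^sub>R v - (lip v w / lip u v) *\<^sub>R u"
    have r: "r \<in> perp (lsum (span {u}) (span {v}))"
    proof -
      have "lip (c *\<^sub>R u + d *\<^sub>R v) r = 0" for c d
        using assms vu by (simp add: r_def lip_simps lip_commute[of v u])
      moreover have "\<exists>c d. x = c *\<^sub>R u + d *\<^sub>R v" if "x \<in> lsum (span {u}) (span {v})" for x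
        using that unfolding lsum_def span_singleton by blast
      ultimately show ?thesis unfolding perp_def by blast
    qed
    have w: "w = r + (lip u w / lip u v) *\<^sub>R v + (lip v w / lip u v) *\<^sub>R u"
      by (simp add: r_def)
    have "T r = r" "T v = s *\<^sub>R v" "T u = (1 / s) *\<^sub>R u"
      using T r by (auto simp: span_base)
    then have "T w = r + (lip u w / lip u v) *\<^sub>R s *\<^sub>R v + (lip v w / lip u v) *\<^sub>R (1 / s) *\<^sub>R u"
      by (subst w) (simp add: add scaleR)
    then show "T w = boost u v s w"
      by (simp add: boost_def r_def algebra_simps diff_divide_distrib)
  qed
qed

lemma boost_swap: "boost v u s = boost u v (1 / s)"
  by (auto simp: boost_def lip_commute[of v u])

lemma boost_inverse:
  assumes "lip u u = 0" "lip v v = 0" "lip u v \<noteq> 0" "s \<noteq> 0"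
  shows "boost u v s (boost u v (1 / s) w) = w"
proof -
  have "boost u v s (boost u v (1 / s) w) =
    w + ((1 / s - 1) * lip u w / lip u v + (s - 1) * (lip u w / s) / lip u v) *\<^sub>R v
      + ((s - 1) * lip v w / lip u v + (1 / s - 1) * (s * lip v w) / lip u v) *\<^sub>R u"
  proof -
    have 1: "lip u (boost u v (1 / s) w) = lip u w / s"
      using assms by (simp add: boost_def lip_simps field_simps)
    have 2: "lip v (boost u v (1 / s) w) = s * lip v w"
      using assms by (simp add: boost_def lip_simps lip_commute[of v u] field_simps)
    show ?thesis
      unfolding boost_def[of u v s "boost u v (1 / s) w"] 1 2
      by (simp add: boost_def algebra_simps)
  qed
  also have "(1 / s - 1) * lip u w / lip u v + (s - 1) * (lip u w / s) / lip u v =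
      ((1 / s - 1) + (s - 1) / s) * (lip u w / lip u v)"
    by (simp only: divide_inverse algebra_simps mult_1_left)
  also have "(s - 1) * lip v w / lip u v + (1 / s - 1) * (s * lip v w) / lip u v =
      ((s - 1) + (1 / s - 1) * s) * (lip v w / lip u v)"
    by (simp only: divide_inverse algebra_simps mult_1_left)
  also have "(s - 1) + (1 / s - 1) * s = 0"
    using assms by (simp add: left_diff_distrib)
  also have "(1 / s - 1) + (s - 1) / s = 0"
    using assms by (simp add: diff_divide_distrib)
  finally show ?thesis by simp
qed

lemma boost_lip:
  assumes "lip u u = 0" "lip v v = 0" "lip u v \<noteq> 0" "s \<noteq> 0"
  shows "lip (boost u v s x) (boost u v s y) = lip x y"
proof -
  have x: "lip u (boost u v s x) = s * lip u x" "lip v (boost u v s x) = lip v x / s" for x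
    using assms by (simp_all add: boost_def lip_simps lip_commute[of v u] field_simps)
  have "lip (boost u v s x) (boost u v s y) = lip x (boost u v s y)
     + ((s - 1) * lip u x / lip u v) * lip v (boost u v s y)
     + ((1 / s - 1) * lip v x / lip u v) * lip u (boost u v s y)"
    by (subst (1) boost_def) (simp add: lip_simps)
  also have "lip x (boost u v s y) = lip x y + (s - 1) * (lip u y * lip v x / lip u v)
     + (1 / s - 1) * (lip u x * lip v y / lip u v)"
    by (simp add: boost_def lip_simps lip_commute[of x] mult_ac)
  also have "\<dots> + (s - 1) * lip u x / lip u v * lip v (boost u v s y)
     + (1 / s - 1) * lip v x / lip u v * lip u (boost u v s y)
     = lip x y + ((s - 1) + (1 / s - 1) * s) * (lip u y * lip v x / lip u v)
      + ((1 / s - 1) + (s - 1) / s) * (lip u x * lip v y / lip u v)"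
    unfolding x by (simp only: divide_inverse algebra_simps mult_1_left)
  also have "(s - 1) + (1 / s - 1) * s = 0"
    using assms by (simp add: left_diff_distrib)
  also have "(1 / s - 1) + (s - 1) / s = 0"
    using assms by (simp add: diff_divide_distrib)
  finally show ?thesis by simp
qed

lemma linear_wedge: "linear (wedge u v)"
  by (rule linearI) (simp_all add: wedge_def lip_simps algebra_simps)

lemma wedge_scaleR: "wedge (a *\<^sub>R u) (b *\<^sub>R v) = (\<lambda>w. (a * b) *\<^sub>R wedge u v w)"
  by (intro ext) (simp add: wedge_def lip_simps algebra_simps)

text \<open>A wedge of two orthogonal null vectors squares to zero, so the exponential series stops after
  the linear term.\<close>

lemma exp_tau_wedge:
  assumes "lip u u = 0" "lip v v = 0" "lip u v = 0"
  shows "exp_tau t (wedge u v) w = w + t *\<^sub>R wedge u v w"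
proof -
  let ?T = "\<lambda>w. t *\<^sub>R wedge u v w"
  have "(?T ^^ k) w = 0" if "k \<notin> {..<2}" for k
  proof -
    have "k = Suc (Suc (k - 2))" using that by auto
    then obtain j where "k = Suc (Suc j)" by blast
    moreover have "?T (?T x) = 0" for x
      using assms by (simp add: wedge_def lip_simps lip_commute[of v u])
    ultimately show ?thesis by simp
  qed
  then have "exp_tau t (wedge u v) w = (\<Sum>k<2. (1 / fact k) *\<^sub>R (?T ^^ k) w)"
    unfolding exp_tau_def op_exp_def by (intro suminf_finite) auto
  then show ?thesis by (simp add: numeral_2_eq_2 lessThan_Suc)
qed

text \<open>The wedge of two null lines, normalised by the product of the spanning vectors so that the choice
  of these vectors cancels. It generates the one-parameter group of boosts: the derivative at
  \<open>t = 0\<close> of \<open>boost u v (1 - t / \<mu>)\<close> is \<open>- (1 / \<mu>) unit_wedge u v\<close>.\<close>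

definition unit_wedge :: "r42 \<Rightarrow> r42 \<Rightarrow> r42 \<Rightarrow> r42" where
  "unit_wedge u v w = (1 / lip u v) *\<^sub>R wedge u v w"

lemma unit_wedge_scaleR:
  assumes "a \<noteq> 0" "b \<noteq> 0"
  shows "unit_wedge (a *\<^sub>R u) (b *\<^sub>R v) = unit_wedge u v"
  using assms by (intro ext) (simp add: unit_wedge_def wedge_scaleR lip_simps)

text \<open>The vectors \<open>u\<close>, \<open>u'\<close> span the isotropic pair at one end of an edge, and \<open>v\<close>, \<open>v'\<close> the pair at
  the other end, where \<open>v' = exp(\<mu> \<tau>) v\<close> for \<open>\<tau> = u \<and> u'\<close>. All four vectors lie in the degenerate
  space spanned by \<open>u\<close>, \<open>v\<close> and a null vector \<open>N\<close> orthogonal to both: \<open>u'\<close> is a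
  multiple of \<open>u\<close> plus \<open>N\<close>, and \<open>v'\<close> is \<open>v\<close> plus a multiple of \<open>N\<close>. In these coordinates the gauge
  relation between the two boosts is a comparison of three coefficients, and it forces the operator
  \<open>\<sigma>\<close> at the other end to be the multiple of \<open>v \<and> v'\<close> given here. Its second description, as \<open>\<tau>\<close>
  plus a difference of normalised wedges, is the first order part of that relation in \<open>t\<close>; it is
  the form that can be compared with derivatives.\<close>

lemma exp_wedge_intertwines_boosts:
  fixes u u' v :: r42 and \<mu> :: real
  defines "v' \<equiv> v + \<mu> *\<^sub>R wedge u u' v"
  defines "\<sigma> \<equiv> wedge ((1 / (\<mu>\<^sup>2 * lip u v * lip u' v)) *\<^sub>R v) v'"
  assumes null: "lip u u = 0" "lip u' u' = 0" "lip u u' = 0" "lip v v = 0"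
    and nz: "lip u v \<noteq> 0" "lip u' v \<noteq> 0" "\<mu> \<noteq> 0"
  shows "lip v' v' = 0" "lip v v' = 0" "lip u' v' = lip u' v"
    "\<sigma> w = wedge u u' w + (1 / \<mu>) *\<^sub>R (unit_wedge u v w - unit_wedge u' v' w)"
    "t \<noteq> \<mu> \<Longrightarrow> boost u' v' (1 - t / \<mu>) w =
       (let x = boost u v (1 - t / \<mu>) (w - t *\<^sub>R wedge u u' w) in x + t *\<^sub>R \<sigma> x)"
proof -
  define p where "p = lip u v"
  define q where "q = lip u' v"
  \<comment> \<open>the combination of \<open>u\<close> and \<open>u'\<close> that is orthogonal to \<open>v\<close>, and null\<close>
  define N where "N = u' - (q / p) *\<^sub>R u"
  have pq: "p \<noteq> 0" "q \<noteq> 0" using nz by (auto simp: p_def q_def)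
  have u': "u' = (q / p) *\<^sub>R u + N" by (simp add: N_def)
  have N: "lip N N = 0" "lip u N = 0" "lip N u = 0" "lip v N = 0" "lip N v = 0"
    "lip v u = p" "lip u v = p"
    using null pq by (simp_all add: N_def lip_simps p_def q_def lip_commute[of v u]
      lip_commute[of v u'] lip_commute[of u' u])
  have v': "v' = v + (\<mu> * p) *\<^sub>R N"
    using pq by (simp add: v'_def wedge_def u' lip_simps N algebra_simps)
  have \<tau>: "wedge u u' x = lip u x *\<^sub>R N - lip N x *\<^sub>R u" for x
    by (simp add: u' wedge_def lip_simps algebra_simps)
  have \<sigma>: "\<sigma> x = (1 / (\<mu> * q)) *\<^sub>R (lip v x *\<^sub>R N - lip N x *\<^sub>R v)" for x
    using pq nz unfolding \<sigma>_def p_def[symmetric] q_def[symmetric]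
    by (simp add: v' wedge_def lip_simps algebra_simps power2_eq_square)
  have q: "lip u' v' = q" using pq by (simp add: u' v' lip_simps N null)
  show "lip v' v' = 0" "lip v v' = 0" "lip u' v' = lip u' v"
    using q by (simp_all add: v' N null lip_simps q_def)
  show "\<sigma> w = wedge u u' w + (1 / \<mu>) *\<^sub>R (unit_wedge u v w - unit_wedge u' v' w)"
  proof -
    have "unit_wedge u v w - unit_wedge u' v' w = ((lip v w + \<mu> * p * lip N w) / p - lip v w / p) *\<^sub>R u
      + (lip u w / p - (q / p * lip u w + lip N w) / q) *\<^sub>R v
      + ((lip v w + \<mu> * p * lip N w) / q - \<mu> * p * (q / p * lip u w + lip N w) / q) *\<^sub>R N"
      using pq unfolding unit_wedge_def q p_def[symmetric] wedge_def
      by (simp add: u' v' lip_simps algebra_simps add_divide_distrib)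
    also have "\<dots> = (\<mu> * lip N w) *\<^sub>R u + (- lip N w / q) *\<^sub>R v
      + (lip v w / q - \<mu> * lip u w) *\<^sub>R N"
    proof -
      have "(lip v w + \<mu> * p * lip N w) / p - lip v w / p = \<mu> * lip N w"
        "lip u w / p - (q / p * lip u w + lip N w) / q = - lip N w / q"
        "(lip v w + \<mu> * p * lip N w) / q - \<mu> * p * (q / p * lip u w + lip N w) / q
          = lip v w / q - \<mu> * lip u w"
        using pq by (simp_all add: field_simps)
      then show ?thesis by (simp only:)
    qed
    finally have "unit_wedge u v w - unit_wedge u' v' w = (\<mu> * lip N w) *\<^sub>R u + (- lip N w / q) *\<^sub>R v
      + (lip v w / q - \<mu> * lip u w) *\<^sub>R N" .
    then show ?thesis
      using nz unfolding \<sigma> \<tau> by (simp only:) (simp add: algebra_simps)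
  qed
  assume "t \<noteq> \<mu>"
  define s where "s = 1 - t / \<mu>"
  have s: "s \<noteq> 0" using \<open>t \<noteq> \<mu>\<close> nz by (simp add: s_def field_simps)
  have t: "t = \<mu> * (1 - s)" using nz by (simp add: s_def)
  define x where "x = boost u v s (w - t *\<^sub>R wedge u u' w)"
  have x: "x = w + ((s - 1) * lip u w / p) *\<^sub>R v
     + ((1 / s - 1) * (lip v w + \<mu> * (1 - s) * p * lip N w) / p + \<mu> * (1 - s) * lip N w) *\<^sub>R u
     - (\<mu> * (1 - s) * lip u w) *\<^sub>R N"
    unfolding x_def boost_def \<tau> t
    by (simp add: lip_simps N null algebra_simps)
  have vx: "lip v x = (lip v w + \<mu> * (1 - s) * p * lip N w) / s"
  proof -
    define K where "K = 1 / s - 1"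
    define X where "X = lip v w + \<mu> * (1 - s) * p * lip N w"
    have "lip v x = lip v w + (K * X / p + \<mu> * (1 - s) * lip N w) * p"
      unfolding x K_def[symmetric] X_def[symmetric] by (simp add: lip_simps N null)
    also have "\<dots> = X + K * X" using pq by (simp add: X_def distrib_right)
    also have "\<dots> = X / s" by (simp add: K_def left_diff_distrib)
    finally show ?thesis by (simp only: X_def)
  qed
  have Nx: "lip N x = lip N w" by (simp add: x lip_simps N)
  have "boost u' v' s w = x + t *\<^sub>R \<sigma> x"
  proof -
    define A where "A = (s - 1) * lip u' w / q"
    define B where "B = (1 / s - 1) * lip v' w / q"
    have A: "A = (s - 1) * lip u w / p - (1 - s) / q * lip N w"
    proof -
      have "A = (s - 1) * (q / p * lip u w) / q + (s - 1) * lip N w / q"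
        unfolding A_def u' by (simp only: lip_simps real_scaleR_def distrib_left add_divide_distrib)
      then show ?thesis using pq by (simp add: algebra_simps diff_divide_distrib)
    qed
    have B: "B = (1 / s - 1) / q * (lip v w + \<mu> * p * lip N w)"
      unfolding B_def v' by (simp add: lip_simps)
    have L: "boost u' v' s w = w + A *\<^sub>R v + (B * (q / p)) *\<^sub>R u + (A * (\<mu> * p) + B) *\<^sub>R N"
      unfolding boost_def q A_def[symmetric] B_def[symmetric]
      by (simp add: u' v' algebra_simps)
    have R: "x + t *\<^sub>R \<sigma> x = w + ((s - 1) * lip u w / p - (1 - s) / q * lip N w) *\<^sub>R v
      + ((1 / s - 1) * (lip v w + \<mu> * (1 - s) * p * lip N w) / p + \<mu> * (1 - s) * lip N w) *\<^sub>R u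
      + ((1 - s) / q * lip v x - \<mu> * (1 - s) * lip u w) *\<^sub>R N"
    proof -
      have "t *\<^sub>R \<sigma> x = ((1 - s) / q) *\<^sub>R (lip v x *\<^sub>R N - lip N w *\<^sub>R v)"
        using nz by (simp add: \<sigma> Nx t)
      moreover have "x + r *\<^sub>R (y *\<^sub>R N - lip N w *\<^sub>R v) = w + ((s - 1) * lip u w / p - r * lip N w) *\<^sub>R v
        + ((1 / s - 1) * (lip v w + \<mu> * (1 - s) * p * lip N w) / p + \<mu> * (1 - s) * lip N w) *\<^sub>R u
        + (r * y - \<mu> * (1 - s) * lip u w) *\<^sub>R N" for r y
        unfolding x by (simp add: scaleR_left_distrib scaleR_left_diff_distrib scaleR_right_diff_distrib)
      ultimately show ?thesis by simp
    qed
    have b: "(1 / s - 1) * (lip v w + \<mu> * (1 - s) * p * lip N w) / p + \<mu> * (1 - s) * lip N w = B * (q / p)"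
    proof -
      have "1 - s = (1 / s - 1) * s" using s by (simp add: field_simps)
      then have "\<mu> * (1 - s) * lip N w = (1 / s - 1) * (\<mu> * s * p * lip N w) / p"
        using pq by simp
      moreover have "B * (q / p) = (1 / s - 1) * (lip v w + \<mu> * p * lip N w) / p"
        using pq unfolding B by simp
      moreover have "lip v w + \<mu> * (1 - s) * p * lip N w + \<mu> * s * p * lip N w = lip v w + \<mu> * p * lip N w"
        by (simp add: algebra_simps)
      ultimately show ?thesis
        by (metis add_divide_distrib distrib_left)
    qed
    have c: "(1 - s) / q * lip v x - \<mu> * (1 - s) * lip u w = A * (\<mu> * p) + B"
    proof -
      have "A * (\<mu> * p) = (s - 1) * lip u w / p * (\<mu> * p) - (1 - s) / q * (\<mu> * p * lip N w)"
        unfolding A left_diff_distrib by (simp only: mult.assoc mult.commute mult.left_commute)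
      moreover have "(s - 1) * lip u w / p * (\<mu> * p) = - (\<mu> * (1 - s) * lip u w)"
      proof -
        have "(s - 1) * lip u w / p * (\<mu> * p) = (s - 1) * lip u w * \<mu>" using pq by simp
        then show ?thesis by (simp add: algebra_simps)
      qed
      moreover have "(1 - s) / q * lip v x
        = (1 / s - 1) / q * (lip v w + \<mu> * p * lip N w) - (1 - s) / q * (\<mu> * p * lip N w)"
      proof -
        define K where "K = (1 / s - 1) / q"
        define X where "X = lip v w + \<mu> * (1 - s) * p * lip N w"
        have "(1 / s - 1) * s = 1 - s" using s by (simp add: left_diff_distrib)
        then have K: "(1 - s) / q = K * s" by (metis K_def times_divide_eq_left)
        have "K * s * (X / s) = K * X" using s by simp
        moreover have "X = lip v w + \<mu> * p * lip N w - s * (\<mu> * p * lip N w)"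
          unfolding X_def by (simp add: algebra_simps)
        ultimately show ?thesis
          unfolding vx X_def[symmetric] K K_def[symmetric] by (simp only: right_diff_distrib mult.assoc)
      qed
      ultimately show ?thesis unfolding B by simp
    qed
    show ?thesis unfolding L R b c A[symmetric] ..
  qed
  then show "boost u' v' (1 - t / \<mu>) w =
       (let x = boost u v (1 - t / \<mu>) (w - t *\<^sub>R wedge u u' w) in x + t *\<^sub>R \<sigma> x)"
    by (simp add: Let_def x_def s_def)
qed

text \<open>Bianchi permutability rests on this product formula. Going along the edges from \<open>u\<close> to \<open>v\<close> and from
  \<open>v\<close> to \<open>x\<close> amounts to a single boost for the diagonal between \<open>v\<close> and \<open>w\<close>, in which \<open>u\<close> and \<open>x\<close> no
  longer occur. The diagonal is the same for the other way round the quadrilateral.\<close>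

lemma boost_triangle:
  fixes u v w :: r42 and \<alpha> \<beta> :: real
  defines "x \<equiv> boost u v (1 - \<beta> / \<alpha>) w"
  assumes null: "lip u u = 0" "lip v v = 0" "lip w w = 0"
    and nz: "lip u v \<noteq> 0" "lip u w \<noteq> 0" "lip v w \<noteq> 0"
    and par: "\<alpha> \<noteq> 0" "\<beta> \<noteq> 0" "\<alpha> \<noteq> \<beta>" "t \<noteq> \<alpha>" "t \<noteq> \<beta>"
  shows "boost v x (1 - t / \<beta>) (boost u v (1 - t / \<alpha>) y) =
    boost w v ((1 - t / \<alpha>) / (1 - t / \<beta>)) y"
proof -
  define p q r where "p = lip u v" and "q = lip u w" and "r = lip v w"
  define U V W where "U = lip u y" and "V = lip v y" and "W = lip w y"
  note d = p_def[symmetric] q_def[symmetric] r_def[symmetric]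
    U_def[symmetric] V_def[symmetric] W_def[symmetric]
  have pqr: "p \<noteq> 0" "q \<noteq> 0" "r \<noteq> 0" using nz by (auto simp: d)
  have par': "\<alpha> - \<beta> \<noteq> 0" "\<alpha> - t \<noteq> 0" "\<beta> - t \<noteq> 0" using par by auto
  have sym: "lip v u = p" "lip w v = r" by (simp_all add: d lip_commute)
  have x: "x = w - (\<beta> * q / (\<alpha> * p)) *\<^sub>R v + (\<beta> * r / ((\<alpha> - \<beta>) * p)) *\<^sub>R u"
  proof -
    have "1 / (1 - \<beta> / \<alpha>) - 1 = \<beta> / (\<alpha> - \<beta>)" "1 - \<beta> / \<alpha> - 1 = - (\<beta> / \<alpha>)"
      using par par' by (simp_all add: field_simps)
    then show ?thesis using par pqr unfolding x_def boost_def d by (simp add: algebra_simps)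
  qed
  have vx: "lip v x = \<alpha> * r / (\<alpha> - \<beta>)"
    using pqr par' null by (simp add: x lip_simps d sym field_simps)
  have ux: "lip u x = q * (\<alpha> - \<beta>) / \<alpha>"
    using pqr par null by (simp add: x lip_simps d sym field_simps)
  have xy: "lip x y = W - \<beta> * q / (\<alpha> * p) * V + \<beta> * r / ((\<alpha> - \<beta>) * p) * U"
    by (simp add: x lip_simps d)
  define z where "z = boost u v (1 - t / \<alpha>) y"
  have s: "1 / (1 - t / \<alpha>) - 1 = t / (\<alpha> - t)" "1 - t / \<alpha> - 1 = - (t / \<alpha>)"
    "1 / (1 - t / \<beta>) - 1 = t / (\<beta> - t)" "1 - t / \<beta> - 1 = - (t / \<beta>)"
    using par par' by (simp_all add: field_simps)
  have z: "z = y - (t * U / (\<alpha> * p)) *\<^sub>R v + (t * V / ((\<alpha> - t) * p)) *\<^sub>R u"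
    unfolding z_def boost_def d s by simp
  have vz: "lip v z = \<alpha> * V / (\<alpha> - t)"
    using pqr par par' null by (simp add: z lip_simps d sym field_simps)
  have xz: "lip x z = W - \<beta> * q / (\<alpha> * p) * V + \<beta> * r / ((\<alpha> - \<beta>) * p) * U
      - t * U / (\<alpha> * p) * (\<alpha> * r / (\<alpha> - \<beta>)) + t * V / ((\<alpha> - t) * p) * (q * (\<alpha> - \<beta>) / \<alpha>)"
    unfolding z by (simp add: lip_simps xy lip_commute[of x v] lip_commute[of x u] vx ux)
  define a where "a = - (t / \<beta>) * lip v z / lip v x"
  define b where "b = t / (\<beta> - t) * lip x z / lip v x"
  have a: "a = - (t * (\<alpha> - \<beta>) * V / (\<beta> * (\<alpha> - t) * r))"
    using par par' pqr unfolding a_def vz vx by (simp add: field_simps)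
  have "boost v x (1 - t / \<beta>) z = z + a *\<^sub>R x + b *\<^sub>R v"
    unfolding boost_def s a_def b_def by simp
  also have "\<dots> = y + (b - t * U / (\<alpha> * p) - a * (\<beta> * q / (\<alpha> * p))) *\<^sub>R v + a *\<^sub>R w
     + (t * V / ((\<alpha> - t) * p) + a * (\<beta> * r / ((\<alpha> - \<beta>) * p))) *\<^sub>R u"
    unfolding z x by (simp add: algebra_simps)
  also have "t * V / ((\<alpha> - t) * p) + a * (\<beta> * r / ((\<alpha> - \<beta>) * p)) = 0"
  proof -
    define D E where "D = \<alpha> - \<beta>" and "E = \<alpha> - t"
    show ?thesis
      using par par' pqr unfolding a D_def[symmetric] E_def[symmetric] by simp
  qed
  also have "b - t * U / (\<alpha> * p) - a * (\<beta> * q / (\<alpha> * p)) = t * (\<alpha> - \<beta>) * W / ((\<beta> - t) * \<alpha> * r)"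
  proof -
    have b': "b = t * (\<alpha> - \<beta>) / ((\<beta> - t) * \<alpha> * r) * lip x z"
      using par par' pqr unfolding b_def vx by (simp add: field_simps)
    have "lip x z = W + V * (q / (\<alpha> * p)) * (t * (\<alpha> - \<beta>) / (\<alpha> - t) - \<beta>)
        + U * r / (p * (\<alpha> - \<beta>)) * (\<beta> - t)"
    proof -
      define D E where "D = \<alpha> - \<beta>" and "E = \<alpha> - t"
      have "t * U / (\<alpha> * p) * (\<alpha> * r / D) = t * (U * r / (p * D))"
        using par by simp
      then show ?thesis
        unfolding xz D_def[symmetric] E_def[symmetric]
        by (simp only: divide_inverse algebra_simps inverse_mult_distrib)
    qed
    also have "t * (\<alpha> - \<beta>) / (\<alpha> - t) - \<beta> = \<alpha> * (t - \<beta>) / (\<alpha> - t)"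
      using par' by (simp add: field_simps)
    finally have "b = t * (\<alpha> - \<beta>) * W / ((\<beta> - t) * \<alpha> * r)
       - t * (\<alpha> - \<beta>) * V * q / (\<alpha> * r * p * (\<alpha> - t)) + t * U / (\<alpha> * p)"
    proof -
      assume e: "lip x z = W + V * (q / (\<alpha> * p)) * (\<alpha> * (t - \<beta>) / (\<alpha> - t))
        + U * r / (p * (\<alpha> - \<beta>)) * (\<beta> - t)"
      have 1: "t * (\<alpha> - \<beta>) / ((\<beta> - t) * \<alpha> * r) * (V * (q / (\<alpha> * p)) * (\<alpha> * (t - \<beta>) / (\<alpha> - t)))
        = - (t * (\<alpha> - \<beta>) * V * q / (\<alpha> * r * p * (\<alpha> - t)))"
      proof -
        define D E F where "D = \<alpha> - \<beta>" and "E = \<alpha> - t" and "F = \<beta> - t"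
        have "t - \<beta> = - F" by (simp add: F_def)
        then show ?thesis
          using par par' pqr unfolding D_def[symmetric] E_def[symmetric] F_def[symmetric]
          by (simp add: mult_ac)
      qed
      have 2: "t * (\<alpha> - \<beta>) / ((\<beta> - t) * \<alpha> * r) * (U * r / (p * (\<alpha> - \<beta>)) * (\<beta> - t))
        = t * U / (\<alpha> * p)"
      proof -
        define D F where "D = \<alpha> - \<beta>" and "F = \<beta> - t"
        show ?thesis
          using par par' pqr unfolding D_def[symmetric] F_def[symmetric] by (simp add: mult_ac)
      qed
      show ?thesis unfolding b' e distrib_left 1 2 by simp
    qed
    moreover have "a * (\<beta> * q / (\<alpha> * p)) = - (t * (\<alpha> - \<beta>) * V * q / (\<alpha> * r * p * (\<alpha> - t)))"
    proof -
      define D E where "D = \<alpha> - \<beta>" and "E = \<alpha> - t"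
      show ?thesis
        using par par' pqr unfolding a D_def[symmetric] E_def[symmetric] by (simp add: mult_ac)
    qed
    ultimately show ?thesis by simp
  qed
  finally have 1: "boost v x (1 - t / \<beta>) z = y + (t * (\<alpha> - \<beta>) * W / ((\<beta> - t) * \<alpha> * r)) *\<^sub>R v
      + a *\<^sub>R w" by simp
  have 2: "1 / ((1 - t / \<alpha>) / (1 - t / \<beta>)) - 1 = - (t * (\<alpha> - \<beta>) / (\<beta> * (\<alpha> - t)))"
    "(1 - t / \<alpha>) / (1 - t / \<beta>) - 1 = t * (\<alpha> - \<beta>) / ((\<beta> - t) * \<alpha>)"
    using par par' by (simp_all add: divide_simps) (simp_all add: algebra_simps)
  have "boost w v ((1 - t / \<alpha>) / (1 - t / \<beta>)) y =
      y + (t * (\<alpha> - \<beta>) * W / ((\<beta> - t) * \<alpha> * r)) *\<^sub>R v + a *\<^sub>R w"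
    unfolding boost_def 2 d sym a by simp
  with 1 show ?thesis by (simp add: z_def)
qed


lemma null_lineE:
  assumes "null_line a"
  obtains u where "a = span {u}" "u \<noteq> 0" "lip u u = 0"
  using assms by (auto simp: null_line_def)

lemma null_line_span: "v \<noteq> 0 \<Longrightarrow> lip v v = 0 \<Longrightarrow> null_line (span {v})"
  unfolding null_line_def by blast

lemma orth_span: "orth (span {u}) (span {v}) \<longleftrightarrow> lip u v = 0"
proof
  show "lip u v = 0" if "orth (span {u}) (span {v})"
    using that by (auto simp: orth_def span_base)
  show "orth (span {u}) (span {v})" if "lip u v = 0"
    using that by (simp add: orth_def span_singleton lip_simps)
qed

lemma orth_commute: "orth a b \<longleftrightarrow> orth b a"
  unfolding orth_def by (metis lip_commute)

lemma span_singleton_eq: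
  fixes u :: "'a::real_vector"
  assumes "x \<in> span {u}" "x \<noteq> 0"
  shows "span {x} = span {u}" "\<exists>c. c \<noteq> 0 \<and> x = c *\<^sub>R u"
proof -
  obtain c where x: "x = c *\<^sub>R u" using assms by (auto simp: span_singleton)
  with assms have c: "c \<noteq> 0" by auto
  with x show "\<exists>c. c \<noteq> 0 \<and> x = c *\<^sub>R u" by auto
  have "u = (1 / c) *\<^sub>R x" using c x by simp
  then have "u \<in> span {x}" by (metis span_base span_scale singletonI)
  then show "span {x} = span {u}" using assms by (simp add: span_eq)
qed

lemma image_span_singleton:
  assumes "linear T"
  shows "T ` span {v} = span {T v}"
  using linear_span_image[OF assms, of "{v}"] by simp

lemma Gam_boost:
  assumes "null_line a" "null_line b" "\<not> orth a b" "u \<in> a" "v \<in> b" "u \<noteq> 0" "v \<noteq> 0"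
  shows "lip u v \<noteq> 0" "lip u u = 0" "lip v v = 0" "s \<noteq> 0 \<Longrightarrow> Gam a b s = boost u v s"
proof -
  obtain u0 v0 where 0: "a = span {u0}" "b = span {v0}" "lip u0 u0 = 0" "lip v0 v0 = 0"
    using assms null_lineE by metis
  obtain c d where "u = c *\<^sub>R u0" "v = d *\<^sub>R v0" using assms 0 by (auto simp: span_singleton)
  then show "lip u u = 0" "lip v v = 0" using 0 by (simp_all add: lip_simps)
  moreover have ab: "a = span {u}" "b = span {v}"
    using assms span_singleton_eq(1)[of u u0] span_singleton_eq(1)[of v v0] 0 by auto
  ultimately show "lip u v \<noteq> 0" using assms by (simp add: orth_span)
  then show "Gam a b s = boost u v s" if "s \<noteq> 0"
    using Gam_span[of u v s] that \<open>lip u u = 0\<close> \<open>lip v v = 0\<close> ab by simp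
qed

lemma Gam_inverse:
  assumes "null_line a" "null_line b" "\<not> orth a b" "s \<noteq> 0"
  shows "Gam a b s (Gam b a s w) = w" "inv (Gam a b s) = Gam a b (1 / s)"
proof -
  obtain u v where uv: "a = span {u}" "u \<noteq> 0" "b = span {v}" "v \<noteq> 0" "lip u u = 0" "lip v v = 0"
    using assms null_lineE by metis
  then have nz: "lip u v \<noteq> 0" using assms by (simp add: orth_span)
  have G: "Gam a b r = boost u v r" "Gam b a r = boost u v (1 / r)" if "r \<noteq> 0" for r
    using Gam_span[of u v r] Gam_span[of v u r] that uv nz lip_commute[of u v]
    by (simp_all add: boost_swap[of v u])
  show "Gam a b s (Gam b a s w) = w"
    unfolding G(1)[OF assms(4)] G(2)[OF assms(4)] by (rule boost_inverse[OF uv(5,6) nz assms(4)])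
  show "inv (Gam a b s) = Gam a b (1 / s)"
  proof -
    have s: "1 / s \<noteq> 0" using assms by simp
    show ?thesis
      unfolding G(1)[OF assms(4)] G(1)[OF s]
      using boost_inverse[OF uv(5,6) nz assms(4)] boost_inverse[OF uv(5,6) nz s]
      by (intro inv_equality) simp_all
  qed
qed

lemma Gam_fixes:
  assumes "null_line a" "null_line b" "\<not> orth a b" "s \<noteq> 0" "c \<in> perp a" "c \<in> perp b"
  shows "Gam a b s c = c"
proof -
  obtain u v where uv: "a = span {u}" "u \<noteq> 0" "b = span {v}" "v \<noteq> 0"
    using assms null_lineE by metis
  then have "u \<in> a" "v \<in> b" by (auto simp: span_base)
  then have "Gam a b s = boost u v s" "lip u c = 0" "lip v c = 0"
    using assms uv Gam_boost(4)[of a b u v s] by (auto simp: perp_def)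
  then show ?thesis by (simp add: boost_def)
qed

lemma perp_Gam_image:
  assumes "null_line a" "null_line b" "\<not> orth a b" "s \<noteq> 0" "c \<in> perp a" "c \<in> perp b" "c \<in> perp d"
  shows "c \<in> perp (Gam a b s ` d)"
proof -
  obtain u v where uv: "a = span {u}" "u \<noteq> 0" "b = span {v}" "v \<noteq> 0"
    using assms null_lineE by metis
  then have "u \<in> a" "v \<in> b" by (auto simp: span_base)
  then have "Gam a b s = boost u v s" "lip u c = 0" "lip v c = 0"
    using assms uv Gam_boost(4)[of a b u v s] by (auto simp: perp_def)
  then show ?thesis using assms by (auto simp: perp_def boost_def lip_simps)
qed

lemma null_line_Gam_image:
  assumes "null_line a" "null_line b" "\<not> orth a b" "s \<noteq> 0" "null_line d"
  shows "null_line (Gam a b s ` d)"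
proof -
  obtain u v where uv: "a = span {u}" "u \<noteq> 0" "b = span {v}" "v \<noteq> 0"
    using assms null_lineE by metis
  obtain w where w: "d = span {w}" "w \<noteq> 0" "lip w w = 0" using assms null_lineE by metis
  from uv have "u \<in> a" "v \<in> b" by (auto simp: span_base)
  note G = Gam_boost[OF assms(1-3) this uv(2,4)]
  have "Gam a b s ` d = span {boost u v s w}"
    using G(4)[OF assms(4)] w by (simp add: image_span_singleton linear_boost)
  moreover have "boost u v s w \<noteq> 0"
  proof
    assume "boost u v s w = 0"
    moreover have "boost u v (1 / s) (boost u v s w) = w"
      using boost_inverse[of u v "1 / s" w] G assms by simp
    ultimately show False using w(2) linear_0[OF linear_boost, of u v "1 / s"] by simp
  qed
  moreover have "lip (boost u v s w) (boost u v s w) = 0"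
    using boost_lip[of u v s w w] G assms w by simp
  ultimately show ?thesis by (simp add: null_line_span)
qed

text \<open>By \<open>boost_triangle\<close> both sides are the boost with the null lines \<open>aj\<close> and \<open>al\<close>; exchanging the two lines
  inverts the parameter, as does exchanging \<open>\<alpha>\<close> and \<open>\<beta>\<close>. Both expressions for \<open>ak\<close> enter, one for
  each side.\<close>

lemma Gam_permutability:
  assumes nl: "null_line ai" "null_line aj" "null_line al"
    and no: "\<not> orth ai aj" "\<not> orth ai al" "\<not> orth aj ak" "\<not> orth al ak"
    and k: "ak = Gam ai aj (1 - \<beta> / \<alpha>) ` al" "ak = Gam ai al (1 - \<alpha> / \<beta>) ` aj"
    and par: "\<alpha> \<noteq> 0" "\<beta> \<noteq> 0" "\<alpha> \<noteq> \<beta>" "t \<noteq> \<alpha>" "t \<noteq> \<beta>"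
  shows "Gam aj ak (1 - t / \<beta>) \<circ> Gam ai aj (1 - t / \<alpha>) = Gam al ak (1 - t / \<alpha>) \<circ> Gam ai al (1 - t / \<beta>)"
proof -
  obtain u v w where uvw: "ai = span {u}" "aj = span {v}" "al = span {w}"
    "lip u u = 0" "lip v v = 0" "lip w w = 0"
    using nl null_lineE by metis
  have nz: "lip u v \<noteq> 0" "lip u w \<noteq> 0" using no uvw by (auto simp: orth_span)
  have s: "1 - \<beta> / \<alpha> \<noteq> 0" "1 - \<alpha> / \<beta> \<noteq> 0" "1 - t / \<alpha> \<noteq> 0" "1 - t / \<beta> \<noteq> 0"
    using par by auto
  define x where "x = boost u v (1 - \<beta> / \<alpha>) w"
  define x' where "x' = boost u w (1 - \<alpha> / \<beta>) v"
  have ak: "ak = span {x}" "ak = span {x'}"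
    using k uvw nz s by (simp_all add: Gam_span image_span_singleton linear_boost x_def x'_def)
  have vx: "lip v x \<noteq> 0" and wx: "lip w x' \<noteq> 0"
    using no(3) no(4) ak uvw(2,3) by (metis orth_span)+
  have nx: "lip x x = 0" "lip x' x' = 0"
    using boost_lip[of u v "1 - \<beta> / \<alpha>" w w] boost_lip[of u w "1 - \<alpha> / \<beta>" v v] uvw nz s
    by (simp_all add: x_def x'_def)
  have vw: "lip v w \<noteq> 0"
  proof
    assume "lip v w = 0"
    then have "lip v x = 0" using uvw by (simp add: x_def boost_def lip_simps)
    with vx show False by simp
  qed
  then have wv: "lip w v \<noteq> 0" by (simp add: lip_commute)
  show ?thesis
  proof
    fix y
    have "Gam aj ak (1 - t / \<beta>) (Gam ai aj (1 - t / \<alpha>) y) =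
        boost w v ((1 - t / \<alpha>) / (1 - t / \<beta>)) y"
      using boost_triangle[of u v w \<alpha> \<beta> t y] uvw nz vw vx nx par s ak(1)
      by (simp add: Gam_span x_def)
    moreover have "Gam al ak (1 - t / \<alpha>) (Gam ai al (1 - t / \<beta>) y) =
        boost v w ((1 - t / \<beta>) / (1 - t / \<alpha>)) y"
      using boost_triangle[of u w v \<beta> \<alpha> t y] uvw nz wv wx nx par s ak(2)
      by (simp add: Gam_span x'_def)
    ultimately show "(Gam aj ak (1 - t / \<beta>) \<circ> Gam ai aj (1 - t / \<alpha>)) y =
        (Gam al ak (1 - t / \<alpha>) \<circ> Gam ai al (1 - t / \<beta>)) y"
      by (simp add: boost_swap[of v w])
  qed
qed

section \<open>Edges between isotropic pairs\<close>

text \<open>The data at one vertex. Nonvanishing of \<open>\<tau>\<close> makes the two lines distinct, so that they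
  span a plane.\<close>

definition isotropic_pair :: "r42 set \<Rightarrow> r42 set \<Rightarrow> (r42 \<Rightarrow> r42) \<Rightarrow> bool" where
  "isotropic_pair a a' \<tau> \<longleftrightarrow> null_line a \<and> null_line a' \<and> orth a a' \<and> \<tau> \<in> wedge_set a a' \<and> \<tau> \<noteq> (\<lambda>_. 0)"

lemma isotropic_pairE:
  assumes "isotropic_pair a a' \<tau>"
  obtains u u' where "a = span {u}" "a' = span {u'}" "lip u u = 0" "lip u' u' = 0" "lip u u' = 0"
    "\<tau> = wedge u u'" "u \<noteq> 0" "u' \<noteq> 0"
proof -
  obtain x y where a: "a = span {x}" "a' = span {y}" "lip x x = 0" "lip y y = 0" "lip x y = 0"
    using assms by (metis isotropic_pair_def null_lineE orth_span)
  obtain u u' where u: "u \<in> a" "u' \<in> a'" "\<tau> = wedge u u'"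
    using assms by (auto simp: isotropic_pair_def wedge_set_def)
  moreover have "u \<noteq> 0" "u' \<noteq> 0" using assms u by (auto simp: isotropic_pair_def wedge_def lip_simps)
  moreover have "a = span {u}" "a' = span {u'}"
    using a u \<open>u \<noteq> 0\<close> \<open>u' \<noteq> 0\<close> span_singleton_eq(1) by metis+
  moreover have "lip u u = 0" "lip u' u' = 0" "lip u u' = 0"
    using a u by (auto simp: span_singleton lip_simps)
  ultimately show ?thesis using that by metis
qed

lemma exp_tau_isotropic_pair:
  assumes "isotropic_pair a a' \<tau>"
  shows "exp_tau t \<tau> w = w + t *\<^sub>R \<tau> w" "\<tau> (\<tau> w) = 0" "linear \<tau>"
proof -
  obtain u u' where u: "a = span {u}" "a' = span {u'}" "lip u u = 0" "lip u' u' = 0" "lip u u' = 0"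
    "\<tau> = wedge u u'" "u \<noteq> 0" "u' \<noteq> 0"
    using assms by (rule isotropic_pairE)
  show "exp_tau t \<tau> w = w + t *\<^sub>R \<tau> w" "linear \<tau>"
    unfolding u(6) by (rule exp_tau_wedge[OF u(3-5)] linear_wedge)+
  show "\<tau> (\<tau> w) = 0"
    using u(3-5) unfolding u(6) by (simp add: wedge_def lip_simps lip_commute[of u' u])
qed

lemma linear_exp_tau:
  assumes "isotropic_pair a a' \<tau>"
  shows "linear (exp_tau t \<tau>)"
  using exp_tau_isotropic_pair[OF assms]
  by (intro linearI) (simp_all add: linear_add linear_scale algebra_simps)

lemma exp_tau_inverse:
  assumes "isotropic_pair a a' \<tau>"
  shows "exp_tau t \<tau> (exp_tau (- t) \<tau> w) = w" "exp_tau (- t) \<tau> (exp_tau t \<tau> w) = w"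
  using exp_tau_isotropic_pair[OF assms] by (simp_all add: linear_add linear_diff linear_scale linear_neg)

lemma null_plane_isotropic_pair:
  assumes "isotropic_pair a a' \<tau>"
  shows "null_plane (lsum a a')"
proof -
  obtain u u' where u: "a = span {u}" "a' = span {u'}" "lip u u = 0" "lip u' u' = 0" "lip u u' = 0"
    "\<tau> = wedge u u'" "u \<noteq> 0" "u' \<noteq> 0"
    using assms by (rule isotropic_pairE)
  have L: "lsum a a' = span {u, u'}"
  proof -
    have "{u, u'} = {u} \<union> {u'}" by auto
    then show ?thesis unfolding lsum_def u(1,2) by (simp only: span_Un)
  qed
  have "u \<notin> span {u'}"
  proof
    assume "u \<in> span {u'}"
    then obtain c where "u = c *\<^sub>R u'" by (auto simp: span_singleton)
    then have "\<tau> = (\<lambda>_. 0)" unfolding u(6) by (intro ext) (simp add: wedge_def lip_simps)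
    with assms show False by (simp add: isotropic_pair_def)
  qed
  moreover from this have "u \<noteq> u'" by (auto simp: span_base)
  ultimately have "independent {u, u'}" "u \<noteq> u'"
    using u(8) by (simp_all add: independent_insert)
  then have "dim (span {u, u'}) = 2" by (simp add: dim_eq_card_independent)
  moreover have "lip (c *\<^sub>R u + d *\<^sub>R u') (e *\<^sub>R u + f *\<^sub>R u') = 0" for c d e f
    using u by (simp add: lip_simps lip_commute[of u' u])
  moreover have "\<exists>c d. x = c *\<^sub>R u + d *\<^sub>R u'" if "x \<in> lsum a a'" for x
    using that unfolding lsum_def u(1,2) span_singleton by blast
  ultimately have "dim (lsum a a') = 2" "\<forall>x\<in>lsum a a'. \<forall>y\<in>lsum a a'. lip x y = 0"
    unfolding L by metis+
  then show ?thesis unfolding null_plane_def by (simp add: L)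
qed

text \<open>The data on one edge with parameter \<open>\<mu>\<close>: the gauge relation of a discrete isotropic Darboux pair
  together with \<open>b' = exp(\<mu> \<tau>) b\<close>. The latter makes links propagate, since it determines how
  the next pair is built.\<close>

definition link :: "real \<Rightarrow> r42 set \<Rightarrow> r42 set \<Rightarrow> (r42 \<Rightarrow> r42) \<Rightarrow> r42 set \<Rightarrow> r42 set \<Rightarrow> (r42 \<Rightarrow> r42) \<Rightarrow> bool" where
  "link \<mu> a a' \<tau> b b' \<sigma> \<longleftrightarrow> isotropic_pair a a' \<tau> \<and> isotropic_pair b b' \<sigma> \<and>
     \<not> orth a b \<and> \<not> orth a' b' \<and> b' = exp_tau \<mu> \<tau> ` b \<and>
     (\<forall>t. t \<noteq> \<mu> \<longrightarrow> Gam a' b' (1 - t / \<mu>) = exp_tau t \<sigma> \<circ> Gam a b (1 - t / \<mu>) \<circ> exp_tau (- t) \<tau>)"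

lemma linkD:
  assumes "link \<mu> a a' \<tau> b b' \<sigma>"
  shows "isotropic_pair a a' \<tau>" "isotropic_pair b b' \<sigma>" "\<not> orth a b" "\<not> orth a' b'" "b' = exp_tau \<mu> \<tau> ` b"
    "t \<noteq> \<mu> \<Longrightarrow> Gam a' b' (1 - t / \<mu>) = exp_tau t \<sigma> \<circ> Gam a b (1 - t / \<mu>) \<circ> exp_tau (- t) \<tau>"
  using assms unfolding link_def by blast+

text \<open>The condition \<open>b' = exp(\<mu> \<tau>) b\<close> alone produces the operator at the other vertex. Its explicit value
  serves to compare it with the operator of a smooth isotropic Darboux pair.\<close>

lemma link_exists:
  assumes pair: "isotropic_pair a a' \<tau>" and b: "null_line b" "b' = exp_tau \<mu> \<tau> ` b"
    and no: "\<not> orth a b" "\<not> orth a' b'" and \<mu>: "\<mu> \<noteq> 0"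
  obtains \<sigma> where "link \<mu> a a' \<tau> b b' \<sigma>"
    "\<And>u v u' v' w. \<lbrakk>u \<in> a; v \<in> b; u' \<in> a'; v' \<in> b'; u \<noteq> 0; v \<noteq> 0; u' \<noteq> 0; v' \<noteq> 0\<rbrakk> \<Longrightarrow>
       \<sigma> w = \<tau> w + (1 / \<mu>) *\<^sub>R (unit_wedge u v w - unit_wedge u' v' w)"
proof -
  obtain u u' where u: "a = span {u}" "a' = span {u'}" "lip u u = 0" "lip u' u' = 0" "lip u u' = 0"
    "\<tau> = wedge u u'" "u \<noteq> 0" "u' \<noteq> 0"
    using pair by (rule isotropic_pairE)
  obtain v where v: "b = span {v}" "v \<noteq> 0" "lip v v = 0" using b null_lineE by metis
  define v' where "v' = v + \<mu> *\<^sub>R wedge u u' v"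
  define \<sigma> where "\<sigma> = wedge ((1 / (\<mu>\<^sup>2 * lip u v * lip u' v)) *\<^sub>R v) v'"
  have b': "b' = span {v'}"
  proof -
    have "exp_tau \<mu> \<tau> v = v'"
      using exp_tau_isotropic_pair(1)[OF pair, of \<mu> v] by (simp add: v'_def u(6))
    then show ?thesis unfolding b v image_span_singleton[OF linear_exp_tau[OF pair]] by simp
  qed
  have "lip u' v' = lip u' v"
    using u by (simp add: v'_def wedge_def lip_simps lip_commute[of u' u])
  then have nz: "lip u v \<noteq> 0" "lip u' v \<noteq> 0" "lip u' v' \<noteq> 0"
    using no u v b' by (auto simp: orth_span)
  note E = exp_wedge_intertwines_boosts[OF u(3,4,5) v(3) nz(1,2) \<mu>, folded v'_def, folded \<sigma>_def]
  have \<sigma>0: "\<sigma> \<noteq> (\<lambda>_. 0)"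
  proof
    assume "\<sigma> = (\<lambda>_. 0)"
    then have "0 = \<sigma> u" by simp
    also have "\<sigma> u = (1 / (\<mu>\<^sup>2 * lip u v * lip u' v)) *\<^sub>R wedge v v' u"
      by (simp add: \<sigma>_def wedge_def lip_simps algebra_simps)
    also have "wedge v v' u = (\<mu> * lip u v) *\<^sub>R (lip u v *\<^sub>R u' - lip u' v *\<^sub>R u)"
      using u by (simp add: wedge_def v'_def lip_simps lip_commute[of v u] lip_commute[of u' u] algebra_simps)
    finally have "lip u v *\<^sub>R u' = lip u' v *\<^sub>R u" using nz \<mu> by simp
    then have "(1 / lip u v) *\<^sub>R lip u v *\<^sub>R u' = (1 / lip u v) *\<^sub>R lip u' v *\<^sub>R u" by simp
    then have "u' = (lip u' v / lip u v) *\<^sub>R u" using nz by simp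
    then obtain c where "u' = c *\<^sub>R u" by blast
    then have "\<tau> = (\<lambda>_. 0)" unfolding u(6)
      by (intro ext) (simp add: wedge_def lip_simps)
    with pair show False by (simp add: isotropic_pair_def)
  qed
  have pair': "isotropic_pair b b' \<sigma>"
  proof -
    have "v' \<noteq> 0" using nz by (auto simp: lip_simps)
    moreover have "(1 / (\<mu>\<^sup>2 * lip u v * lip u' v)) *\<^sub>R v \<in> b" "v' \<in> b'"
      by (simp_all add: v b' span_base span_scale)
    ultimately have "null_line b'" "\<sigma> \<in> wedge_set b b'"
      using E(1) unfolding wedge_set_def \<sigma>_def b' by (blast intro: null_line_span)+
    then show ?thesis
      using E(2) v b' \<sigma>0 b(1) unfolding isotropic_pair_def by (simp add: orth_span)
  qed
  have "link \<mu> a a' \<tau> b b' \<sigma>"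
    unfolding link_def
  proof (intro conjI allI impI pair pair' no b)
    fix t assume t: "t \<noteq> \<mu>"
    have s: "1 - t / \<mu> \<noteq> 0" using t \<mu> by auto
    have 1: "Gam a' b' (1 - t / \<mu>) = boost u' v' (1 - t / \<mu>)"
      unfolding u b' using u E(1) nz s by (intro Gam_span) auto
    have 2: "Gam a b (1 - t / \<mu>) = boost u v (1 - t / \<mu>)"
      unfolding u v using u v nz s by (intro Gam_span) auto
    show "Gam a' b' (1 - t / \<mu>) = exp_tau t \<sigma> \<circ> Gam a b (1 - t / \<mu>) \<circ> exp_tau (- t) \<tau>"
      unfolding 1 2
      by (intro ext) (simp add: E(5)[OF t] Let_def exp_tau_wedge[OF u(3-5)]
          exp_tau_isotropic_pair(1)[OF pair'] u(6))
  qed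
  moreover have "\<sigma> w = \<tau> w + (1 / \<mu>) *\<^sub>R (unit_wedge x y w - unit_wedge x' y' w)"
    if h: "x \<in> a" "y \<in> b" "x' \<in> a'" "y' \<in> b'" "x \<noteq> 0" "y \<noteq> 0" "x' \<noteq> 0" "y' \<noteq> 0" for x y x' y' w
  proof -
    obtain c d c' d' where "x = c *\<^sub>R u" "y = d *\<^sub>R v" "x' = c' *\<^sub>R u'" "y' = d' *\<^sub>R v'"
      "c \<noteq> 0" "d \<noteq> 0" "c' \<noteq> 0" "d' \<noteq> 0"
      using h unfolding u v b' using span_singleton_eq(2) by metis
    then show ?thesis using E(4)[of w] by (simp add: unit_wedge_scaleR u(6))
  qed
  ultimately show ?thesis using that by blast
qed

text \<open>A discrete isotropic Darboux pair asks for the gauge relation on both orientations of an edge; the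
  reversed boosts are inverse to the original ones.\<close>

lemma link_reverse:
  assumes l: "link \<mu> a a' \<tau> b b' \<sigma>" and t: "t \<noteq> \<mu>" "\<mu> \<noteq> 0"
  shows "Gam b' a' (1 - t / \<mu>) = exp_tau t \<tau> \<circ> Gam b a (1 - t / \<mu>) \<circ> exp_tau (- t) \<sigma>"
proof
  fix z
  have s: "1 - t / \<mu> \<noteq> 0" using t by auto
  have p: "isotropic_pair a a' \<tau>" "isotropic_pair b b' \<sigma>" and no: "\<not> orth a b" "\<not> orth b a" "\<not> orth b' a'"
    using l orth_commute by (auto simp: link_def)
  then have nl: "null_line a" "null_line a'" "null_line b" "null_line b'"
    by (auto simp: isotropic_pair_def)
  define y where "y = exp_tau t \<tau> (Gam b a (1 - t / \<mu>) (exp_tau (- t) \<sigma> z))"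
  have "Gam a' b' (1 - t / \<mu>) y = exp_tau t \<sigma> (Gam a b (1 - t / \<mu>) (exp_tau (- t) \<tau> y))"
    unfolding linkD(6)[OF l t(1)] by simp
  also have "\<dots> = z"
    unfolding y_def
    by (simp add: exp_tau_inverse[OF p(1)] exp_tau_inverse[OF p(2)] Gam_inverse(1)[OF nl(1,3) no(1) s])
  finally have "Gam b' a' (1 - t / \<mu>) z = y"
    using Gam_inverse(1)[OF nl(4,2) no(3) s] by metis
  then show "Gam b' a' (1 - t / \<mu>) z = (exp_tau t \<tau> \<circ> Gam b a (1 - t / \<mu>) \<circ> exp_tau (- t) \<sigma>) z"
    by (simp add: y_def)
qed

text \<open>Links are compatible with Bianchi quadrilaterals. Evaluating the gauge relation on the edge from \<open>i\<close>
  to \<open>j\<close> at \<open>t = \<beta>\<close> turns \<open>al' = exp(\<beta> \<tau>i) al\<close> into \<open>ak' = exp(\<beta> \<tau>j) ak\<close>, so there is an operator at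
  \<open>k\<close> that completes a link from \<open>j\<close>, and in the same way one that completes a link from \<open>l\<close>. Both
  conjugate the transport from \<open>i\<close> to \<open>k\<close> of the one sign into that of the other sign. By
  permutability this transport does not depend on the path, so the exponentials of the two operators
  agree.\<close>

lemma link_quadrilateral:
  assumes ij: "link \<alpha> ai ai' \<tau>i aj aj' \<tau>j" and il: "link \<beta> ai ai' \<tau>i al al' \<tau>l"
    and k: "ak = Gam ai aj (1 - \<beta> / \<alpha>) ` al" "ak = Gam ai al (1 - \<alpha> / \<beta>) ` aj"
    and k': "ak' = Gam ai' aj' (1 - \<beta> / \<alpha>) ` al'" "ak' = Gam ai' al' (1 - \<alpha> / \<beta>) ` aj'"
    and no: "\<not> orth aj ak" "\<not> orth al ak" "\<not> orth aj' ak'" "\<not> orth al' ak'"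
    and par: "\<alpha> \<noteq> 0" "\<beta> \<noteq> 0" "\<alpha> \<noteq> \<beta>"
  shows "\<exists>\<kappa>. link \<beta> aj aj' \<tau>j ak ak' \<kappa> \<and> link \<alpha> al al' \<tau>l ak ak' \<kappa>"
proof -
  have pi: "isotropic_pair ai ai' \<tau>i" and pj: "isotropic_pair aj aj' \<tau>j" and pl: "isotropic_pair al al' \<tau>l"
    using ij il by (auto simp: link_def)
  then have nl: "null_line ai" "null_line aj" "null_line al" "null_line ai'" "null_line aj'" "null_line al'"
    by (auto simp: isotropic_pair_def)
  have s: "1 - \<beta> / \<alpha> \<noteq> 0" "1 - \<alpha> / \<beta> \<noteq> 0" using par by auto
  have nij: "\<not> orth ai aj" "\<not> orth ai al" "\<not> orth ai' aj'" "\<not> orth ai' al'"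
    using ij il by (auto simp: link_def)
  have nk: "null_line ak" unfolding k(1) by (intro null_line_Gam_image nl nij s)
  have "ak' = exp_tau \<beta> \<tau>j ` Gam ai aj (1 - \<beta> / \<alpha>) ` exp_tau (- \<beta>) \<tau>i ` exp_tau \<beta> \<tau>i ` al"
    unfolding k'(1) linkD(6)[OF ij par(3)[symmetric]] by (simp only: image_comp o_assoc flip: linkD(5)[OF il])
  then have kj: "ak' = exp_tau \<beta> \<tau>j ` ak"
    unfolding k(1) by (simp add: image_comp comp_def exp_tau_inverse[OF pi])
  have "ak' = exp_tau \<alpha> \<tau>l ` Gam ai al (1 - \<alpha> / \<beta>) ` exp_tau (- \<alpha>) \<tau>i ` exp_tau \<alpha> \<tau>i ` aj"
    unfolding k'(2) linkD(6)[OF il par(3)] by (simp only: image_comp o_assoc flip: linkD(5)[OF ij])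
  then have kl: "ak' = exp_tau \<alpha> \<tau>l ` ak"
    unfolding k(2) by (simp add: image_comp comp_def exp_tau_inverse[OF pi])
  obtain \<kappa> where \<kappa>: "link \<beta> aj aj' \<tau>j ak ak' \<kappa>"
    using link_exists[OF pj nk kj no(1,3) par(2)] by metis
  obtain \<kappa>' where \<kappa>': "link \<alpha> al al' \<tau>l ak ak' \<kappa>'"
    using link_exists[OF pl nk kl no(2,4) par(1)] by metis
  have pk: "isotropic_pair ak ak' \<kappa>" "isotropic_pair ak ak' \<kappa>'" using \<kappa> \<kappa>' by (auto simp: link_def)
  \<comment> \<open>one parameter away from \<open>0\<close>, \<open>\<alpha>\<close> and \<open>\<beta>\<close> suffices, the exponential being affine in the operator\<close>
  define t where "t = 1 + \<bar>\<alpha>\<bar> + \<bar>\<beta>\<bar>"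
  have t: "t \<noteq> \<alpha>" "t \<noteq> \<beta>" "t \<noteq> 0" unfolding t_def by linarith+
  define M where "M = Gam aj ak (1 - t / \<beta>) \<circ> Gam ai aj (1 - t / \<alpha>)"
  have M: "M = Gam al ak (1 - t / \<alpha>) \<circ> Gam ai al (1 - t / \<beta>)"
    unfolding M_def by (rule Gam_permutability[OF nl(1-3) nij(1,2) no(1,2) k par t(1,2)])
  have M': "Gam aj' ak' (1 - t / \<beta>) \<circ> Gam ai' aj' (1 - t / \<alpha>) =
      Gam al' ak' (1 - t / \<alpha>) \<circ> Gam ai' al' (1 - t / \<beta>)"
    by (rule Gam_permutability[OF nl(4-6) nij(3,4) no(3,4) k' par t(1,2)])
  have "Gam aj' ak' (1 - t / \<beta>) \<circ> Gam ai' aj' (1 - t / \<alpha>) = exp_tau t \<kappa> \<circ> M \<circ> exp_tau (- t) \<tau>i"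
    unfolding linkD(6)[OF \<kappa> t(2)] linkD(6)[OF ij t(1)] M_def
    by (simp add: fun_eq_iff exp_tau_inverse[OF pj])
  moreover have "Gam al' ak' (1 - t / \<alpha>) \<circ> Gam ai' al' (1 - t / \<beta>) = exp_tau t \<kappa>' \<circ> M \<circ> exp_tau (- t) \<tau>i"
    unfolding linkD(6)[OF \<kappa>' t(1)] linkD(6)[OF il t(2)] M
    by (simp add: fun_eq_iff exp_tau_inverse[OF pl])
  ultimately have eq: "exp_tau t \<kappa> (M (exp_tau (- t) \<tau>i w)) = exp_tau t \<kappa>' (M (exp_tau (- t) \<tau>i w))" for w
    using M' by (metis comp_apply)
  have "\<kappa> z = \<kappa>' z" for z
  proof -
    have s: "1 - t / \<beta> \<noteq> 0" "1 - t / \<alpha> \<noteq> 0" using t par by auto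
    have "M (exp_tau (- t) \<tau>i (exp_tau t \<tau>i (Gam aj ai (1 - t / \<alpha>) (Gam ak aj (1 - t / \<beta>) z)))) = z"
      using Gam_inverse(1)[OF nl(2) nk no(1) s(1)] Gam_inverse(1)[OF nl(1,2) nij(1) s(2)]
      by (simp add: M_def exp_tau_inverse[OF pi])
    then have "exp_tau t \<kappa> z = exp_tau t \<kappa>' z" using eq by metis
    then show ?thesis
      using t by (simp add: exp_tau_isotropic_pair[OF pk(1)] exp_tau_isotropic_pair[OF pk(2)])
  qed
  then have "\<kappa> = \<kappa>'" by auto
  with \<kappa> \<kappa>' show ?thesis by blast
qed

text \<open>Values on the quadrant computed from the values \<open>S\<close>, \<open>R\<close> on the two axes by a rule \<open>Q\<close> that fills in
  the fourth corner of each quadrilateral.\<close>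

fun grid :: "(nat \<Rightarrow> nat \<Rightarrow> 'a \<Rightarrow> 'a \<Rightarrow> 'a \<Rightarrow> 'a) \<Rightarrow> (nat \<Rightarrow> 'a) \<Rightarrow> (nat \<Rightarrow> 'a) \<Rightarrow> nat \<Rightarrow> nat \<Rightarrow> 'a" where
  "grid Q S R m 0 = S m"
| "grid Q S R 0 (Suc n) = R (Suc n)"
| "grid Q S R (Suc m) (Suc n) = Q m n (grid Q S R m n) (grid Q S R (Suc m) n) (grid Q S R m (Suc n))"

lemma lattice_extension:
  fixes H V :: "nat \<Rightarrow> nat \<Rightarrow> 'a \<Rightarrow> 'a \<Rightarrow> bool"
  assumes row: "\<And>m. H m 0 (S m) (S (Suc m))" and col: "\<And>n. V 0 n (R n) (R (Suc n))" and corner: "S 0 = R 0"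
    and quad: "\<And>m n a b c. H m n a b \<Longrightarrow> V m n a c \<Longrightarrow> \<exists>d. V (Suc m) n b d \<and> H m (Suc n) c d"
  obtains T where "\<And>m n. H m n (T m n) (T (Suc m) n)" "\<And>m n. V m n (T m n) (T m (Suc n))"
proof -
  define Q :: "nat \<Rightarrow> nat \<Rightarrow> 'a \<Rightarrow> 'a \<Rightarrow> 'a \<Rightarrow> 'a" where
    "Q m n a b c = (SOME d. V (Suc m) n b d \<and> H m (Suc n) c d)" for m n a b c
  have Q: "V (Suc m) n b (Q m n a b c) \<and> H m (Suc n) c (Q m n a b c)"
    if "H m n a b" "V m n a c" for m n a b c
    unfolding Q_def by (rule someI_ex[OF quad[OF that]])
  let ?T = "grid Q S R"
  have col': "V 0 n (?T 0 n) (?T 0 (Suc n))" for n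
    using col[of n] corner by (cases n) auto
  have "(\<forall>m. H m n (?T m n) (?T (Suc m) n)) \<and> (\<forall>m. V m n (?T m n) (?T m (Suc n)))" for n
  proof (induction n)
    case 0
    have H: "H m 0 (?T m 0) (?T (Suc m) 0)" for m using row by simp
    have "V m 0 (?T m 0) (?T m (Suc 0))" for m
    proof (induction m)
      case (Suc m) then show ?case using Q[OF H Suc.IH] by simp
    qed (rule col')
    with H show ?case by blast
  next
    case (Suc n)
    have H: "H m (Suc n) (?T m (Suc n)) (?T (Suc m) (Suc n))" for m
      using Q Suc by simp
    have "V m (Suc n) (?T m (Suc n)) (?T m (Suc (Suc n)))" for m
    proof (induction m)
      case (Suc m) then show ?case using Q[OF H Suc.IH] by simp
    qed (rule col')
    with H show ?case by blast
  qed
  then show ?thesis using that by blast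
qed


section \<open>First derivatives of the connections\<close>

lemma chart_preimage_open:
  assumes "smooth_surface A" "(W, \<psi>) \<in> A" "open U"
  shows "open {z\<in>W. \<psi> z \<in> U}"
proof -
  have "\<forall>(W, \<psi>)\<in>A. open W \<and> inj_on \<psi> W \<and> continuous_on W \<psi> \<and>
        (\<forall>V\<subseteq>W. open V \<longrightarrow> open (\<psi> ` V))"
    using assms(1) unfolding smooth_surface_def by (rule conjunct1)
  with assms(2) have "open W" "continuous_on W \<psi>" by fast+
  then have "open (W \<inter> \<psi> -` U)" using assms(3) by (simp add: continuous_open_preimage)
  moreover have "{z\<in>W. \<psi> z \<in> U} = W \<inter> \<psi> -` U" by auto
  ultimately show ?thesis by simp
qed

lemma smooth_map_differentiable:
  assumes "smooth_map A U s" "(W, \<psi>) \<in> A" "y \<in> W" "\<psi> y \<in> U"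
  shows "(\<lambda>z. s (\<psi> z)) differentiable (at y)"
proof -
  have "Ck_on (Suc 0) {y\<in>W. \<psi> y \<in> U} (s \<circ> \<psi>)"
  proof -
    have "\<forall>(W, \<psi>)\<in>A. smooth_on {y\<in>W. \<psi> y \<in> U} (s \<circ> \<psi>)"
      using assms(1) unfolding smooth_map_def .
    with assms(2) have "smooth_on {y\<in>W. \<psi> y \<in> U} (s \<circ> \<psi>)" by fast
    then show ?thesis unfolding smooth_on_def by blast
  qed
  then show ?thesis using assms(3,4) by (simp add: comp_def)
qed

lemma smooth_map_const: "smooth_map A U (\<lambda>_. c)"
proof -
  have "Ck_on k S (\<lambda>_. c)" for k S and c :: 'b
    by (induction k arbitrary: c) auto
  then have "smooth_on S (\<lambda>_. c)" for S by (simp add: smooth_on_def)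
  then show ?thesis unfolding smooth_map_def comp_def by fast
qed

lemma conn_const: "conn \<eta> t (\<lambda>_. w) c y a = t *\<^sub>R \<eta> c y a w"
  by (simp add: conn_def deriv_along_def comp_def)

lemma one_form_linear:
  assumes "isothermic A f \<eta>" "(W, \<psi>) \<in> A" "y \<in> W"
  shows "linear (\<eta> (W, \<psi>) y a)"
proof -
  have "one_form A \<eta>" using assms(1) by (simp add: isothermic_def)
  then have "\<forall>(W, \<psi>)\<in>A. \<forall>y\<in>W. \<forall>a w. linear (\<lambda>a. \<eta> (W, \<psi>) y a w) \<and> linear (\<eta> (W, \<psi>) y a)"
    unfolding one_form_def by (rule conjunct1)
  with assms(2,3) show ?thesis by fast
qed

text \<open>Divided by \<open>t\<close>, the gauge relations hold for small nonzero \<open>t\<close>; their first order part is the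
  limit at \<open>0\<close>.\<close>

lemma eq_at_0_by_continuity:
  fixes g :: "real \<Rightarrow> 'a::t2_space"
  assumes "isCont g 0" "0 < \<epsilon>" "\<And>t. t \<noteq> 0 \<Longrightarrow> \<bar>t\<bar> < \<epsilon> \<Longrightarrow> X = g t"
  shows "X = g 0"
proof -
  have "\<forall>\<^sub>F t in at 0. g t = X"
    unfolding eventually_at using assms(2,3) by (intro exI[of _ \<epsilon>]) (auto simp: dist_real_def)
  moreover have "(g \<longlongrightarrow> g 0) (at 0)" using assms(1) by (simp add: isCont_def)
  ultimately have "((\<lambda>_. X) \<longlongrightarrow> g 0) (at (0::real))" by (rule tendsto_cong[THEN iffD1])
  then show ?thesis by (simp add: tendsto_const_iff)
qed

lemma isCont_linear:
  fixes T :: "r42 \<Rightarrow> r42"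
  assumes "linear T" "isCont g x"
  shows "isCont (\<lambda>t. T (g t)) x"
  by (rule bounded_linear.isCont[OF linear_conv_bounded_linear[THEN iffD1, OF assms(1)] assms(2)])

lemma wedge_setE:
  assumes "\<tau> \<in> wedge_set a b" "null_line a" "null_line b" "orth a b"
  obtains u v where "u \<in> a" "v \<in> b" "\<tau> = wedge u v" "lip u u = 0" "lip v v = 0" "lip u v = 0"
proof -
  obtain u v where uv: "u \<in> a" "v \<in> b" "\<tau> = wedge u v"
    using assms(1) by (auto simp: wedge_set_def)
  moreover have "lip u u = 0" if "u \<in> a" "null_line a" for u a
  proof -
    obtain x where "a = span {x}" "lip x x = 0" using \<open>null_line a\<close> null_lineE by metis
    with \<open>u \<in> a\<close> show ?thesis by (auto simp: span_singleton lip_simps)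
  qed
  ultimately show ?thesis using that assms by (auto simp: orth_def)
qed

lemma exp_tau_wedge_set:
  assumes "\<tau> \<in> wedge_set a b" "null_line a" "null_line b" "orth a b"
  shows "exp_tau t \<tau> w = w + t *\<^sub>R \<tau> w" "linear \<tau>"
proof -
  obtain u v where "\<tau> = wedge u v" "lip u u = 0" "lip v v = 0" "lip u v = 0"
    using assms by (rule wedge_setE)
  then show "exp_tau t \<tau> w = w + t *\<^sub>R \<tau> w" "linear \<tau>"
    by (simp_all only: exp_tau_wedge linear_wedge)
qed

lemma wedge_set_diff:
  assumes "\<tau> \<in> wedge_set a b" "\<sigma> \<in> wedge_set a b" "null_line a" "null_line b"
  shows "(\<lambda>w. \<tau> w - \<sigma> w) \<in> wedge_set a b"
proof -
  obtain u v where a: "a = span {u}" and b: "b = span {v}" using assms null_lineE by metis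
  have "\<exists>c. x = (\<lambda>w. c *\<^sub>R wedge u v w)" if "x \<in> wedge_set a b" for x
    using that unfolding wedge_set_def a b span_singleton by (auto simp: wedge_scaleR)
  then obtain c d where "\<tau> = (\<lambda>w. c *\<^sub>R wedge u v w)" "\<sigma> = (\<lambda>w. d *\<^sub>R wedge u v w)"
    using assms by meson
  then have "(\<lambda>w. \<tau> w - \<sigma> w) = wedge ((c - d) *\<^sub>R u) (1 *\<^sub>R v)"
    unfolding wedge_scaleR by (simp add: scaleR_left_diff_distrib)
  moreover have "(c - d) *\<^sub>R u \<in> a" "1 *\<^sub>R v \<in> b"
    unfolding a b by (intro span_scale span_base; simp)+
  ultimately show ?thesis unfolding wedge_set_def by blast
qed

text \<open>The part of first order in \<open>t\<close> of the gauge relation between the connections of \<open>f\<^sup>+\<close> and \<open>f\<^sup>-\<close>,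
  applied to constant sections: \<open>d\<tau> = \<eta>\<^sup>+ - \<eta>\<^sup>-\<close>.\<close>

lemma isotropic_darboux_derivative:
  assumes pair: "isotropic_darboux A fp \<eta>p fm \<eta>m \<tau>" and orth: "\<And>p. orth (fp p) (fm p)"
    and c: "(W, \<psi>) \<in> A" "y \<in> W"
  shows "((\<lambda>z. \<tau> (\<psi> z) w) has_derivative
     (\<lambda>a. \<eta>p (W, \<psi>) y a w - \<eta>m (W, \<psi>) y a w)) (at y)"
proof -
  have iso: "isothermic A fp \<eta>p" "isothermic A fm \<eta>m"
    and \<tau>w: "\<And>p. \<tau> p \<in> wedge_set (fp p) (fm p)" and sm: "smooth_map A UNIV (\<lambda>p. \<tau> p w)"
    and cc: "\<And>t. conn_conj A t \<eta>m (\<lambda>p. exp_tau t (\<tau> p)) \<eta>p (\<lambda>p. exp_tau (- t) (\<tau> p))"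
    using pair unfolding isotropic_darboux_def by blast+
  have nl: "\<And>p. null_line (fp p)" "\<And>p. null_line (fm p)"
    using iso by (auto simp: isothermic_def null_line_bundle_def)
  note ex = exp_tau_wedge_set(1)[OF \<tau>w nl orth] and lin\<tau> = exp_tau_wedge_set(2)[OF \<tau>w nl orth]
  define D where "D = frechet_derivative (\<lambda>z. \<tau> (\<psi> z) w) (at y)"
  have D: "((\<lambda>z. \<tau> (\<psi> z) w) has_derivative D) (at y)"
    unfolding D_def using smooth_map_differentiable[OF sm c] by (simp add: frechet_derivative_works)
  have "D a = \<eta>p (W, \<psi>) y a w - \<eta>m (W, \<psi>) y a w" for a
  proof -
    let ?p = "\<eta>p (W, \<psi>) y a" and ?m = "\<eta>m (W, \<psi>) y a" and ?T = "\<tau> (\<psi> y)"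
    have linp: "linear ?p" by (rule one_form_linear[OF iso(1) c])
    define Y where "Y t = - D a + ?p (w - t *\<^sub>R ?T w)" for t
    have "?m w = Y t + t *\<^sub>R ?T (Y t)" if "t \<noteq> 0" for t
    proof -
      have "((\<lambda>z. w - t *\<^sub>R \<tau> (\<psi> z) w) has_derivative (\<lambda>h. 0 - t *\<^sub>R D h)) (at y)"
        by (intro has_derivative_diff has_derivative_const has_derivative_scaleR_right D)
      then have "frechet_derivative (\<lambda>z. w - t *\<^sub>R \<tau> (\<psi> z) w) (at y) = (\<lambda>h. 0 - t *\<^sub>R D h)"
        by (rule frechet_derivative_at[symmetric])
      moreover have "(\<lambda>p. exp_tau (- t) (\<tau> p) w) \<circ> \<psi> = (\<lambda>z. w - t *\<^sub>R \<tau> (\<psi> z) w)"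
        by (simp add: ex comp_def)
      ultimately have d: "conn \<eta>p t (\<lambda>p. exp_tau (- t) (\<tau> p) w) (W, \<psi>) y a = t *\<^sub>R Y t"
        unfolding conn_def deriv_along_def Y_def by (simp add: ex scaleR_diff_right scaleR_add_right)
      have "conn \<eta>m t (\<lambda>_. w) (W, \<psi>) y a =
          exp_tau t ?T (conn \<eta>p t (\<lambda>p. exp_tau (- t) (\<tau> p) w) (W, \<psi>) y a)"
        using cc[of t] smooth_map_const[of A UNIV w] c unfolding conn_conj_def by blast
      then have "t *\<^sub>R ?m w = t *\<^sub>R (Y t + t *\<^sub>R ?T (Y t))"
        unfolding d conn_const unfolding ex by (simp add: linear_scale[OF lin\<tau>] scaleR_add_right)
      with that show ?thesis by simp
    qed
    moreover have "isCont (\<lambda>t. Y t + t *\<^sub>R ?T (Y t)) 0"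
      unfolding Y_def by (intro continuous_intros isCont_linear[OF lin\<tau>] isCont_linear[OF linp])
    ultimately have "?m w = Y 0 + 0 *\<^sub>R ?T (Y 0)"
      using eq_at_0_by_continuity[of "\<lambda>t. Y t + t *\<^sub>R ?T (Y t)" 1 "?m w"] by simp
    then show ?thesis by (simp add: Y_def)
  qed
  then have "D = (\<lambda>a. \<eta>p (W, \<psi>) y a w - \<eta>m (W, \<psi>) y a w)" by auto
  with D show ?thesis by simp
qed

lemma isCont_boost:
  assumes "isCont s x" "s x \<noteq> 0" "isCont g x"
  shows "isCont (\<lambda>t. boost u v (s t) (g t)) x"
  unfolding boost_def divide_inverse[of _ "lip u v"]
  using assms by (intro continuous_intros lip.isCont) auto

lemma boost_1: "boost u v 1 w = w"
  by (simp add: boost_def)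

text \<open>The part of first order in \<open>t\<close> of the gauge relation between an isothermic map and its Darboux
  transform: the associated forms differ by the differential of the normalised wedge of the two maps,
  divided by \<open>\<mu>\<close>.\<close>

lemma darboux_transform_derivative:
  assumes darboux: "darboux_transform A \<mu> f \<eta> f' \<eta>'" and c: "(W, \<psi>) \<in> A" "y \<in> W"
    and N: "open N" "y \<in> N" "\<And>z. z \<in> N \<Longrightarrow> f (\<psi> z) = span {u z}" "\<And>z. z \<in> N \<Longrightarrow> f' (\<psi> z) = span {v z}"
    and d: "u differentiable (at y)" "v differentiable (at y)"
  shows "((\<lambda>z. unit_wedge (u z) (v z) w) has_derivative
     (\<lambda>a. \<mu> *\<^sub>R (\<eta>' (W, \<psi>) y a w - \<eta> (W, \<psi>) y a w))) (at y)"
proof -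
  have \<mu>: "\<mu> \<noteq> 0" and iso: "isothermic A f \<eta>" "isothermic A f' \<eta>'" and no: "\<And>p. \<not> orth (f p) (f' p)"
    and cc: "\<And>t. t \<noteq> \<mu> \<Longrightarrow> conn_conj A t \<eta>' (\<lambda>p. Gam (f p) (f' p) (1 - t / \<mu>))
                              \<eta> (\<lambda>p. inv (Gam (f p) (f' p) (1 - t / \<mu>)))"
    using darboux unfolding darboux_transform_def by blast+
  have nl: "\<And>p. null_line (f p)" "\<And>p. null_line (f' p)"
    using iso by (auto simp: isothermic_def null_line_bundle_def)
  have uv: "lip (u z) (v z) \<noteq> 0" "s \<noteq> 0 \<Longrightarrow> Gam (f (\<psi> z)) (f' (\<psi> z)) s = boost (u z) (v z) s" if "z \<in> N" for z s
  proof -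
    have m: "u z \<in> f (\<psi> z)" "v z \<in> f' (\<psi> z)" using N(3,4)[OF that] by (simp_all add: span_base)
    have "lip (u z) (v z) \<noteq> 0" using no[of "\<psi> z"] N(3,4)[OF that] by (simp add: orth_span)
    then have nz: "u z \<noteq> 0" "v z \<noteq> 0" by (auto simp: lip.zero_left lip.zero_right)
    show "lip (u z) (v z) \<noteq> 0" by fact
    show "Gam (f (\<psi> z)) (f' (\<psi> z)) s = boost (u z) (v z) s" if "s \<noteq> 0"
      by (rule Gam_boost(4)[OF nl no m nz that])
  qed
  define P where "P z = (lip (u z) w / lip (u z) (v z)) *\<^sub>R v z" for z
  define R where "R z = (lip (v z) w / lip (u z) (v z)) *\<^sub>R u z" for z
  have lipd: "(\<lambda>z. lip (g z) (h z)) differentiable (at y)"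
    if "g differentiable (at y)" "h differentiable (at y)" for g h
    using that unfolding differentiable_def by (blast intro: lip.FDERIV)
  have "P differentiable (at y)" "R differentiable (at y)"
    unfolding P_def R_def using d uv(1)[OF N(2)]
    by (intro differentiable_scaleR differentiable_divide lipd differentiable_const; simp)+
  then obtain P' R' where P': "(P has_derivative P') (at y)" and R': "(R has_derivative R') (at y)"
    unfolding differentiable_def by blast
  have unit_wedge: "unit_wedge (u z) (v z) w = P z - R z" for z
    by (simp add: unit_wedge_def wedge_def P_def R_def scaleR_diff_right)
  have "P' a - R' a = \<mu> *\<^sub>R (\<eta>' (W, \<psi>) y a w - \<eta> (W, \<psi>) y a w)" for a
  proof -
    let ?e = "\<eta> (W, \<psi>) y a" and ?e' = "\<eta>' (W, \<psi>) y a" and ?B = "boost (u y) (v y)"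
    have line: "linear ?e" by (rule one_form_linear[OF iso(1) c])
    define Y where "Y t = (1 / (\<mu> - t)) *\<^sub>R P' a - (1 / \<mu>) *\<^sub>R R' a + ?e (?B (1 / (1 - t / \<mu>)) w)" for t
    have "?e' w = ?B (1 - t / \<mu>) (Y t)" if t: "t \<noteq> 0" "\<bar>t\<bar> < \<bar>\<mu>\<bar>" for t
    proof -
      have t\<mu>: "t \<noteq> \<mu>" using t by auto
      then have s: "1 - t / \<mu> \<noteq> 0" "1 / (1 - t / \<mu>) \<noteq> 0" "\<mu> - t \<noteq> 0" using \<mu> by auto
      have ss: "1 / (1 - t / \<mu>) - 1 = t * (1 / (\<mu> - t))" "1 - t / \<mu> - 1 = - (t * (1 / \<mu>))"
      proof -
        have "1 - t / \<mu> = (\<mu> - t) / \<mu>" using \<mu> by (simp add: diff_divide_distrib)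
        moreover have "\<mu> / (\<mu> - t) - 1 = t / (\<mu> - t)"
          using diff_divide_distrib[of \<mu> "\<mu> - t" "\<mu> - t"] s(3) by simp
        ultimately show "1 / (1 - t / \<mu>) - 1 = t * (1 / (\<mu> - t))" by simp
      qed simp
      have inv: "inv (Gam (f (\<psi> z)) (f' (\<psi> z)) (1 - t / \<mu>)) w =
          w + (t * (1 / (\<mu> - t))) *\<^sub>R P z + (- (t * (1 / \<mu>))) *\<^sub>R R z" if "z \<in> N" for z
        unfolding Gam_inverse(2)[OF nl no s(1)] uv(2)[OF that s(2)] boost_def P_def R_def
        by (simp add: ss)
      have "((\<lambda>z. w + (t * (1 / (\<mu> - t))) *\<^sub>R P z + (- (t * (1 / \<mu>))) *\<^sub>R R z) has_derivative
          (\<lambda>h. 0 + (t * (1 / (\<mu> - t))) *\<^sub>R P' h + (- (t * (1 / \<mu>))) *\<^sub>R R' h)) (at y)"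
        by (intro has_derivative_add has_derivative_const has_derivative_scaleR_right P' R')
      then have "((\<lambda>z. inv (Gam (f (\<psi> z)) (f' (\<psi> z)) (1 - t / \<mu>)) w) has_derivative
          (\<lambda>h. 0 + (t * (1 / (\<mu> - t))) *\<^sub>R P' h + (- (t * (1 / \<mu>))) *\<^sub>R R' h)) (at y)"
        using N(1,2) by (rule has_derivative_transform_within_open) (simp only: inv)
      then have fd: "frechet_derivative (\<lambda>z. inv (Gam (f (\<psi> z)) (f' (\<psi> z)) (1 - t / \<mu>)) w) (at y) =
          (\<lambda>h. 0 + (t * (1 / (\<mu> - t))) *\<^sub>R P' h + (- (t * (1 / \<mu>))) *\<^sub>R R' h)"
        by (rule frechet_derivative_at[symmetric])
      have inv': "inv (Gam (f (\<psi> y)) (f' (\<psi> y)) (1 - t / \<mu>)) w = ?B (1 / (1 - t / \<mu>)) w"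
        unfolding Gam_inverse(2)[OF nl no s(1)] uv(2)[OF N(2) s(2)] ..
      have dd: "conn \<eta> t (\<lambda>p. inv (Gam (f p) (f' p) (1 - t / \<mu>)) w) (W, \<psi>) y a = t *\<^sub>R Y t"
        unfolding conn_def deriv_along_def comp_def snd_conv fd inv' Y_def
        by (simp add: scaleR_diff_right scaleR_add_right)
      have "conn \<eta>' t (\<lambda>_. w) (W, \<psi>) y a = Gam (f (\<psi> y)) (f' (\<psi> y)) (1 - t / \<mu>)
          (conn \<eta> t (\<lambda>p. inv (Gam (f p) (f' p) (1 - t / \<mu>)) w) (W, \<psi>) y a)"
        using cc[OF t\<mu>] smooth_map_const[of A UNIV w] c unfolding conn_conj_def by blast
      then have "t *\<^sub>R ?e' w = t *\<^sub>R ?B (1 - t / \<mu>) (Y t)"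
        unfolding dd conn_const uv(2)[OF N(2) s(1)] linear_scale[OF linear_boost] .
      with t show ?thesis by simp
    qed
    moreover have "isCont (\<lambda>t. ?B (1 - t / \<mu>) (Y t)) 0"
      unfolding Y_def using \<mu> by (intro isCont_boost continuous_intros isCont_linear[OF line]) auto
    ultimately have "?e' w = ?B (1 - 0 / \<mu>) (Y 0)"
      using eq_at_0_by_continuity[of "\<lambda>t. ?B (1 - t / \<mu>) (Y t)" "\<bar>\<mu>\<bar>" "?e' w"] \<mu> by simp
    also have "\<dots> = (1 / \<mu>) *\<^sub>R (P' a - R' a) + ?e w"
      by (simp add: Y_def boost_1 scaleR_diff_right)
    finally show ?thesis using \<mu> by simp
  qed
  then have "(\<lambda>a. P' a - R' a) = (\<lambda>a. \<mu> *\<^sub>R (\<eta>' (W, \<psi>) y a w - \<eta> (W, \<psi>) y a w))" by auto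
  with has_derivative_diff[OF P' R'] show ?thesis by (simp add: unit_wedge)
qed

section \<open>Rigidity of Legendre immersions\<close>


lemma chartE:
  assumes "smooth_surface A"
  obtains W \<psi> y where "(W, \<psi>) \<in> A" "y \<in> W" "\<psi> y = p" "open W"
proof -
  have "(\<Union>(W, \<psi>)\<in>A. \<psi> ` W) = UNIV" using assms unfolding smooth_surface_def by (elim conjE)
  then have "p \<in> (\<Union>(W, \<psi>)\<in>A. \<psi> ` W)" by simp
  then obtain c where c: "c \<in> A" "p \<in> (case c of (W, \<psi>) \<Rightarrow> \<psi> ` W)" by (elim UN_E)
  obtain W \<psi> where "c = (W, \<psi>)" by (cases c)
  with c obtain y where c: "(W, \<psi>) \<in> A" "y \<in> W" "\<psi> y = p" by auto
  have "\<forall>(W, \<psi>)\<in>A. open W \<and> inj_on \<psi> W \<and> continuous_on W \<psi> \<and>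
        (\<forall>V\<subseteq>W. open V \<longrightarrow> open (\<psi> ` V))"
    using assms unfolding smooth_surface_def by (rule conjunct1)
  with c(1) have "open W" by fast
  with c show ?thesis using that by blast
qed

lemma derivative_in_subspace:
  fixes g :: "'a::real_normed_vector \<Rightarrow> 'b::euclidean_space"
  assumes g: "(g has_derivative g') (at y)" and S: "open S" "y \<in> S" "\<And>z. z \<in> S \<Longrightarrow> g z \<in> V"
    and V: "subspace V"
  shows "g' a \<in> V"
proof -
  have "g' a \<bullet> k = 0" if k: "\<And>x. x \<in> V \<Longrightarrow> x \<bullet> k = 0" for k
  proof -
    have "((\<lambda>z. g z \<bullet> k) has_derivative (\<lambda>h. g' h \<bullet> k)) (at y)"
      by (rule has_derivative_inner_left[OF g])
    moreover have "((\<lambda>z. g z \<bullet> k) has_derivative (\<lambda>h. 0)) (at y)"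
      by (rule has_derivative_transform_within_open[OF has_derivative_const[of 0] S(1,2)]) (simp add: k S(3))
    ultimately have "(\<lambda>h. g' h \<bullet> k) = (\<lambda>h. 0)" by (rule has_derivative_unique)
    then show ?thesis by metis
  qed
  then have "g' a \<in> V\<^sup>\<bottom>\<^sup>\<bottom>"
    unfolding orthogonal_comp_def orthogonal_def by (simp add: inner_commute)
  then show ?thesis using orthogonal_comp_self[OF V] by simp
qed

text \<open>The operator remembers the plane: the metric is nondegenerate, so vectors dual to the two spanning
  null vectors exist and both spanning vectors are values of \<open>\<tau>\<close>.\<close>

lemma range_isotropic_pair:
  assumes "isotropic_pair a a' \<tau>"
  shows "range \<tau> = lsum a a'"
proof -
  obtain u u' where u: "a = span {u}" "a' = span {u'}" "lip u u = 0" "lip u' u' = 0" "lip u u' = 0"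
    "\<tau> = wedge u u'" "u \<noteq> 0" "u' \<noteq> 0"
    using assms by (rule isotropic_pairE)
  have dep: "c = 0" if "c *\<^sub>R u = d *\<^sub>R u'" for c d
  proof (rule ccontr)
    assume "c \<noteq> 0"
    have "(1 / c) *\<^sub>R c *\<^sub>R u = (1 / c) *\<^sub>R d *\<^sub>R u'" using that by simp
    then have "u = (d / c) *\<^sub>R u'" using \<open>c \<noteq> 0\<close> by simp
    then obtain e where "u = e *\<^sub>R u'" by blast
    then have "\<tau> = (\<lambda>_. 0)" unfolding u(6) by (intro ext) (simp add: wedge_def lip_simps)
    with assms show False by (simp add: isotropic_pair_def)
  qed
  have dual: "\<exists>w. lip x w = 1 \<and> lip x' w = 0"
    if nz: "x' \<noteq> 0" and dep: "\<And>c d. c *\<^sub>R x = d *\<^sub>R x' \<Longrightarrow> c = 0" for x x' :: r42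
  proof -
    define z where "z = (x' \<bullet> x') *\<^sub>R x - (x \<bullet> x') *\<^sub>R x'"
    \<comment> \<open>the sign change turns the inner product into \<open>lip\<close>\<close>
    define w where "w = (fst z, - snd z)"
    have lw: "lip k w = k \<bullet> z" for k by (simp add: lip_def w_def inner_prod_def)
    have x'z: "x' \<bullet> z = 0" by (simp add: z_def inner_diff_right inner_commute)
    have "x \<bullet> z \<noteq> 0"
    proof
      assume "x \<bullet> z = 0"
      then have "z \<bullet> z = 0" using x'z by (simp add: z_def inner_diff_left)
      then have "(x' \<bullet> x') *\<^sub>R x = (x \<bullet> x') *\<^sub>R x'" by (simp add: z_def)
      then have "x' \<bullet> x' = 0" by (rule dep)
      with nz show False by simp
    qed
    then have "lip x ((1 / (x \<bullet> z)) *\<^sub>R w) = 1 \<and> lip x' ((1 / (x \<bullet> z)) *\<^sub>R w) = 0"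
      by (simp add: lip_simps lw x'z)
    then show ?thesis by blast
  qed
  obtain w where w: "lip u w = 1" "lip u' w = 0" using dual[of u' u, OF u(8)] dep by metis
  have dep': "c = 0" if "c *\<^sub>R u' = d *\<^sub>R u" for c d
  proof -
    have "d = 0" using dep[of d c] that by simp
    then show ?thesis using that u(8) by simp
  qed
  obtain w' where w': "lip u' w' = 1" "lip u w' = 0" using dual[of u u', OF u(7)] dep' by metis
  show ?thesis
  proof
    have "\<tau> x \<in> lsum a a'" for x
    proof -
      have "(- lip u' x) *\<^sub>R u \<in> a" "lip u x *\<^sub>R u' \<in> a'"
        unfolding u by (intro span_scale span_base; simp)+
      moreover have "\<tau> x = (- lip u' x) *\<^sub>R u + lip u x *\<^sub>R u'" by (simp add: u(6) wedge_def)
      ultimately show ?thesis unfolding lsum_def by blast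
    qed
    then show "range \<tau> \<subseteq> lsum a a'" by blast
    show "lsum a a' \<subseteq> range \<tau>"
    proof
      fix x assume "x \<in> lsum a a'"
      then obtain c d where "x = c *\<^sub>R u + d *\<^sub>R u'"
        unfolding lsum_def u(1,2) span_singleton by blast
      then have "x = \<tau> (d *\<^sub>R w - c *\<^sub>R w')"
        by (simp add: u(6) wedge_def lip_simps w w')
      then show "x \<in> range \<tau>" by blast
    qed
  qed
qed

lemma subset_lsum:
  assumes "0 \<in> a" "0 \<in> b"
  shows "a \<subseteq> lsum a b" "b \<subseteq> lsum a b"
proof -
  have "x \<in> lsum a b" if "x \<in> a" for x
    unfolding lsum_def by (rule CollectI, rule exI[of _ x], rule exI[of _ 0]) (simp add: assms that)
  then show "a \<subseteq> lsum a b" by (rule subsetI)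
  have "x \<in> lsum a b" if "x \<in> b" for x
    unfolding lsum_def by (rule CollectI, rule exI[of _ 0], rule exI[of _ x]) (simp add: assms that)
  then show "b \<subseteq> lsum a b" by (rule subsetI)
qed

lemma legendre_orth:
  assumes "legendre_immersion A (\<lambda>p. lsum (fp p) (fm p))" "null_line (fp p)" "null_line (fm p)"
  shows "orth (fp p) (fm p)"
proof -
  have np: "null_plane (lsum (fp p) (fm p))" using assms(1) unfolding legendre_immersion_def by (elim conjE) (rule spec)
  have "0 \<in> fp p" "0 \<in> fm p" using assms(2,3) by (metis null_lineE span_zero)+
  then have "x \<in> lsum (fp p) (fm p)" if "x \<in> fp p \<or> x \<in> fm p" for x
    using that subset_lsum[of "fp p" "fm p"] by fast
  moreover have "lip x y = 0" if "x \<in> lsum (fp p) (fm p)" "y \<in> lsum (fp p) (fm p)" for x y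
    using np that by (simp add: null_plane_def)
  ultimately show ?thesis unfolding orth_def by blast
qed

text \<open>A section of \<open>f\<^sup>+ \<and> f\<^sup>-\<close> with vanishing derivative is locally constant, and where it is nonzero its range is
  the contact plane. The plane would then be locally constant, so that sections differentiate into
  it, which an immersion excludes. No such section except zero exists; this is the source of all
  uniqueness below.\<close>

lemma legendre_parallel_wedge_vanishes:
  assumes surf: "smooth_surface A" and L: "legendre_immersion A (\<lambda>p. lsum (fp p) (fm p))"
    and nl: "\<And>p. null_line (fp p)" "\<And>p. null_line (fm p)"
    and c: "(W, \<psi>) \<in> A" "open N" "N \<subseteq> W" "y \<in> N"
    and D: "\<And>z. z \<in> N \<Longrightarrow> D z \<in> wedge_set (fp (\<psi> z)) (fm (\<psi> z))"
    and D': "\<And>z w. z \<in> N \<Longrightarrow> ((\<lambda>z. D z w) has_derivative (\<lambda>_. 0)) (at z)"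
  shows "D y = (\<lambda>_. 0)"
proof (rule ccontr)
  assume nz: "D y \<noteq> (\<lambda>_. 0)"
  obtain e where e: "e > 0" "ball y e \<subseteq> N" using c open_contains_ball by blast
  define B where "B = ball y e"
  have B: "open B" "y \<in> B" "B \<subseteq> N" "connected B" using e by (auto simp: B_def)
  have const: "D z = D y" if "z \<in> B" for z
  proof
    fix w
    show "D z w = D y w"
      by (rule has_derivative_zero_unique_connected[OF B(1,4) _ that B(2)]) (use D' B(3) in blast)
  qed
  have pair: "isotropic_pair (fp (\<psi> z)) (fm (\<psi> z)) (D y)" if "z \<in> B" for z
    using nz D[of z] const[OF that] that B(3) nl legendre_orth[OF L nl] unfolding isotropic_pair_def by auto
  define V where "V = lsum (fp (\<psi> y)) (fm (\<psi> y))"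
  have V: "lsum (fp (\<psi> z)) (fm (\<psi> z)) = V" if "z \<in> B" for z
    using range_isotropic_pair[OF pair[OF that]] range_isotropic_pair[OF pair[OF B(2)]] by (simp add: V_def)
  have subV: "subspace V"
    using null_plane_isotropic_pair[OF pair[OF B(2)]] by (simp add: V_def null_plane_def)
  have y: "y \<in> W" using c by blast
  have "\<forall>(W, \<psi>)\<in>A. \<forall>y\<in>W. \<forall>a.
        (\<forall>U s. smooth_section A U (\<lambda>p. lsum (fp p) (fm p)) s \<and> \<psi> y \<in> U \<longrightarrow>
           deriv_along s (W, \<psi>) y a \<in> lsum (fp (\<psi> y)) (fm (\<psi> y))) \<longrightarrow> a = 0"
    using L unfolding legendre_immersion_def by (elim conjE)
  with c(1) y have imm: "a = 0" if "\<And>U s. smooth_section A U (\<lambda>p. lsum (fp p) (fm p)) s \<Longrightarrow> \<psi> y \<in> U \<Longrightarrow>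
           deriv_along s (W, \<psi>) y a \<in> V" for a
    using that unfolding V_def by fast
  have "a = 0" for a :: "real^2"
  proof (rule imm)
    fix U s assume s: "smooth_section A U (\<lambda>p. lsum (fp p) (fm p)) s" and yU: "\<psi> y \<in> U"
    have sU: "open U" "smooth_map A U s" "\<And>p. p \<in> U \<Longrightarrow> s p \<in> lsum (fp p) (fm p)"
      using s unfolding smooth_section_def by blast+
    have d: "((\<lambda>z. s (\<psi> z)) has_derivative frechet_derivative (\<lambda>z. s (\<psi> z)) (at y)) (at y)"
      using smooth_map_differentiable[OF sU(2) c(1) y yU] by (simp add: frechet_derivative_works)
    have "frechet_derivative (\<lambda>z. s (\<psi> z)) (at y) a \<in> V"
    proof (rule derivative_in_subspace[OF d])
      show "open (B \<inter> {z\<in>W. \<psi> z \<in> U})" using B(1) chart_preimage_open[OF surf c(1) sU(1)] by blast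
      show "y \<in> B \<inter> {z\<in>W. \<psi> z \<in> U}" using B(2) y yU by blast
      show "s (\<psi> z) \<in> V" if "z \<in> B \<inter> {z\<in>W. \<psi> z \<in> U}" for z
        using that sU(3)[of "\<psi> z"] V[of z] by auto
    qed (rule subV)
    then show "deriv_along s (W, \<psi>) y a \<in> V" by (simp add: deriv_along_def comp_def)
  qed
  from this[of "axis 1 1"] show False by (simp add: axis_eq_0_iff)
qed

lemma omega_surfaceD:
  assumes "omega_surface A fp \<eta>p fm \<eta>m"
  shows "legendre_immersion A (\<lambda>p. lsum (fp p) (fm p))" "isothermic A fp \<eta>p" "isothermic A fm \<eta>m"
    "null_line (fp p)" "null_line (fm p)" "orth (fp p) (fm p)"
proof -
  show L: "legendre_immersion A (\<lambda>p. lsum (fp p) (fm p))" and i: "isothermic A fp \<eta>p" "isothermic A fm \<eta>m"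
    using assms unfolding omega_surface_def isotropic_darboux_def by blast+
  show nl: "null_line (fp p)" "null_line (fm p)"
    using i by (auto simp: isothermic_def null_line_bundle_def)
  show "orth (fp p) (fm p)" by (rule legendre_orth[OF L nl])
qed

text \<open>Two such operators have the same derivative \<open>\<eta>\<^sup>+ - \<eta>\<^sup>-\<close>.\<close>

lemma isotropic_darboux_unique:
  assumes surf: "smooth_surface A" and om: "omega_surface A fp \<eta>p fm \<eta>m"
    and \<tau>: "isotropic_darboux A fp \<eta>p fm \<eta>m \<tau>" and \<sigma>: "isotropic_darboux A fp \<eta>p fm \<eta>m \<sigma>"
  shows "\<tau> p = \<sigma> p"
proof -
  note om = omega_surfaceD[OF om]
  obtain W \<psi> y where c: "(W, \<psi>) \<in> A" "y \<in> W" "\<psi> y = p" "open W" using chartE[OF surf] .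
  have w: "\<And>p. \<tau> p \<in> wedge_set (fp p) (fm p)" "\<And>p. \<sigma> p \<in> wedge_set (fp p) (fm p)"
    using \<tau> \<sigma> unfolding isotropic_darboux_def by blast+
  have "(\<lambda>w. \<tau> (\<psi> y) w - \<sigma> (\<psi> y) w) = (\<lambda>_. 0)"
  proof (rule legendre_parallel_wedge_vanishes[OF surf om(1,4,5) c(1,4) subset_refl c(2)])
    show "(\<lambda>w. \<tau> (\<psi> z) w - \<sigma> (\<psi> z) w) \<in> wedge_set (fp (\<psi> z)) (fm (\<psi> z))" for z
      by (rule wedge_set_diff[OF w om(4,5)])
    show "((\<lambda>z. \<tau> (\<psi> z) w - \<sigma> (\<psi> z) w) has_derivative (\<lambda>_. 0)) (at z)" if "z \<in> W" for z w
      using has_derivative_diff[OF isotropic_darboux_derivative[OF \<tau> om(6) c(1) that, of w]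
          isotropic_darboux_derivative[OF \<sigma> om(6) c(1) that, of w]] by simp
  qed
  then show ?thesis unfolding c(3) by (intro ext) (metis eq_iff_diff_eq_0)
qed

lemma null_line_bundleE:
  assumes "null_line_bundle A f"
  obtains U s where "p \<in> U" "open U" "smooth_map A U s" "\<And>q. q \<in> U \<Longrightarrow> f q = span {s q}"
  using assms unfolding null_line_bundle_def smooth_section_def by metis

lemma darboux_transformD:
  assumes "darboux_transform A \<mu> f \<eta> f' \<eta>'"
  shows "\<mu> \<noteq> 0" "\<not> orth (f p) (f' p)"
  using assms unfolding darboux_transform_def by blast+

lemma lie_darbouxD:
  assumes "lie_darboux A \<mu> fp \<eta>p fm \<eta>m fp' \<eta>p' fm' \<eta>m'"
  shows "omega_surface A fp \<eta>p fm \<eta>m" "\<mu> \<noteq> 0"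
  using assms darboux_transformD(1) unfolding lie_darboux_def by blast+

text \<open>The values at a point of a Lie-Darboux transformation form a link. The explicit operator \<open>\<sigma>\<close> of
  \<open>link_exists\<close> is \<open>\<tau>\<close> plus normalised wedges, so by the first order relations its derivative is
  \<open>(\<eta>\<^sup>+ - \<eta>\<^sup>-) + (\<eta>'\<^sup>+ - \<eta>\<^sup>+) - (\<eta>'\<^sup>- - \<eta>\<^sup>-) = \<eta>'\<^sup>+ - \<eta>'\<^sup>-\<close>, where \<open>\<eta>'\<close> are the forms of the transforms.
  This is the derivative of \<open>\<tau>'\<close>, and both operators are sections of \<open>f'\<^sup>+ \<and> f'\<^sup>-\<close>, so they coincide.\<close>

lemma lie_darboux_link:
  assumes surf: "smooth_surface A" and ld: "lie_darboux A \<mu> fp \<eta>p fm \<eta>m fp' \<eta>p' fm' \<eta>m'"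
    and om': "omega_surface A fp' \<eta>p' fm' \<eta>m'"
    and \<tau>: "isotropic_darboux A fp \<eta>p fm \<eta>m \<tau>" and \<tau>': "isotropic_darboux A fp' \<eta>p' fm' \<eta>m' \<tau>'"
  shows "link \<mu> (fp x) (fm x) (\<tau> x) (fp' x) (fm' x) (\<tau>' x)"
proof -
  have om: "omega_surface A fp \<eta>p fm \<eta>m"
    and dt: "darboux_transform A \<mu> fp \<eta>p fp' \<eta>p'" "darboux_transform A \<mu> fm \<eta>m fm' \<eta>m'"
    using ld unfolding lie_darboux_def by blast+
  obtain \<tau>0 where \<tau>0: "isotropic_darboux A fp \<eta>p fm \<eta>m \<tau>0" "\<And>p. fm' p = exp_tau \<mu> (\<tau>0 p) ` fp' p"
    using ld unfolding lie_darboux_def by blast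
  have fm': "fm' p = exp_tau \<mu> (\<tau> p) ` fp' p" for p
    by (simp only: \<tau>0(2) isotropic_darboux_unique[OF surf om \<tau> \<tau>0(1)])
  note om = omega_surfaceD[OF om] and om' = omega_surfaceD[OF om']
  have \<mu>: "\<mu> \<noteq> 0" and no: "\<And>p. \<not> orth (fp p) (fp' p)" "\<And>p. \<not> orth (fm p) (fm' p)"
    using darboux_transformD[OF dt(1)] darboux_transformD[OF dt(2)] by simp_all
  have w: "\<And>p. \<tau> p \<in> wedge_set (fp p) (fm p)" "\<And>p. \<tau>' p \<in> wedge_set (fp' p) (fm' p)"
    using \<tau> \<tau>' unfolding isotropic_darboux_def by blast+
  have pair: "isotropic_pair (fp p) (fm p) (\<tau> p)" for p
  proof -
    \<comment> \<open>otherwise the two transforms coincide at \<open>p\<close> and do not span a plane\<close>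
    have "\<tau> p \<noteq> (\<lambda>_. 0)"
    proof
      assume "\<tau> p = (\<lambda>_. 0)"
      then have "exp_tau \<mu> (\<tau> p) w = w" for w
        using exp_tau_wedge_set(1)[OF w(1) om(4-6), of \<mu> p w] by simp
      then have "exp_tau \<mu> (\<tau> p) = (\<lambda>w. w)" by (rule ext)
      then have eq: "fm' p = fp' p" by (simp only: fm' image_ident)
      obtain v where v: "fp' p = span {v}" "v \<noteq> 0" using om'(4) null_lineE by metis
      have "lsum (fp' p) (fm' p) \<subseteq> span {v}" unfolding eq v(1) lsum_def using span_add by blast
      then have "dim (lsum (fp' p) (fm' p)) \<le> card {v}"
        by (rule dim_le_card) simp
      moreover have "null_plane (lsum (fp' p) (fm' p))"
        using om'(1) unfolding legendre_immersion_def by (elim conjE) (rule spec)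
      ultimately show False by (simp add: null_plane_def)
    qed
    then show ?thesis using w(1) om(4-6) unfolding isotropic_pair_def by blast
  qed
  define Q where "Q p s \<longleftrightarrow> link \<mu> (fp p) (fm p) (\<tau> p) (fp' p) (fm' p) s \<and>
     (\<forall>u\<in>fp p. \<forall>v\<in>fp' p. \<forall>u'\<in>fm p. \<forall>v'\<in>fm' p. \<forall>w. u \<noteq> 0 \<longrightarrow> v \<noteq> 0 \<longrightarrow> u' \<noteq> 0 \<longrightarrow> v' \<noteq> 0 \<longrightarrow>
       s w = \<tau> p w + (1 / \<mu>) *\<^sub>R (unit_wedge u v w - unit_wedge u' v' w))" for p s
  have "\<exists>s. Q p s" for p
  proof (rule link_exists[OF pair[of p] om'(4) fm' no \<mu>])
    fix s
    assume 1: "link \<mu> (fp p) (fm p) (\<tau> p) (fp' p) (fm' p) s"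
      and 2: "\<And>u v u' v' w. \<lbrakk>u \<in> fp p; v \<in> fp' p; u' \<in> fm p; v' \<in> fm' p; u \<noteq> 0; v \<noteq> 0; u' \<noteq> 0; v' \<noteq> 0\<rbrakk>
        \<Longrightarrow> s w = \<tau> p w + (1 / \<mu>) *\<^sub>R (unit_wedge u v w - unit_wedge u' v' w)"
    have "Q p s" unfolding Q_def by (intro conjI ballI allI impI 1 2)
    then show "\<exists>s. Q p s" by (rule exI[of "Q p"])
  qed
  then obtain \<sigma> where Q: "\<And>p. Q p (\<sigma> p)" by metis
  have lk: "link \<mu> (fp p) (fm p) (\<tau> p) (fp' p) (fm' p) (\<sigma> p)" for p
    using Q[of p] unfolding Q_def by (rule conjunct1)
  have \<sigma>: "\<sigma> p w = \<tau> p w + (1 / \<mu>) *\<^sub>R (unit_wedge u v w - unit_wedge u' v' w)"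
    if "u \<in> fp p" "v \<in> fp' p" "u' \<in> fm p" "v' \<in> fm' p" "u \<noteq> 0" "v \<noteq> 0" "u' \<noteq> 0" "v' \<noteq> 0" for p u v u' v' w
    using Q[of p] that unfolding Q_def by blast
  obtain W \<psi> y where c: "(W, \<psi>) \<in> A" "y \<in> W" "\<psi> y = x" "open W" using chartE[OF surf] .
  have bundles: "null_line_bundle A fp" "null_line_bundle A fm" "null_line_bundle A fp'" "null_line_bundle A fm'"
    using om(2,3) om'(2,3) unfolding isothermic_def by blast+
  obtain U1 u where u: "x \<in> U1" "open U1" "smooth_map A U1 u" "\<And>q. q \<in> U1 \<Longrightarrow> fp q = span {u q}"
    using null_line_bundleE[OF bundles(1)] by metis
  obtain U2 u' where u': "x \<in> U2" "open U2" "smooth_map A U2 u'" "\<And>q. q \<in> U2 \<Longrightarrow> fm q = span {u' q}"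
    using null_line_bundleE[OF bundles(2)] by metis
  obtain U3 v where v: "x \<in> U3" "open U3" "smooth_map A U3 v" "\<And>q. q \<in> U3 \<Longrightarrow> fp' q = span {v q}"
    using null_line_bundleE[OF bundles(3)] by metis
  obtain U4 v' where v': "x \<in> U4" "open U4" "smooth_map A U4 v'" "\<And>q. q \<in> U4 \<Longrightarrow> fm' q = span {v' q}"
    using null_line_bundleE[OF bundles(4)] by metis
  define N where "N = {z\<in>W. \<psi> z \<in> U1 \<inter> U2 \<inter> U3 \<inter> U4}"
  have N: "open N" "N \<subseteq> W" "y \<in> N" "\<And>z. z \<in> N \<Longrightarrow> \<psi> z \<in> U1" "\<And>z. z \<in> N \<Longrightarrow> \<psi> z \<in> U2"
    "\<And>z. z \<in> N \<Longrightarrow> \<psi> z \<in> U3" "\<And>z. z \<in> N \<Longrightarrow> \<psi> z \<in> U4"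
    unfolding N_def using chart_preimage_open[OF surf c(1), of "U1 \<inter> U2 \<inter> U3 \<inter> U4"] c u(1,2) u'(1,2) v(1,2) v'(1,2)
    by auto
  have \<sigma>N: "\<sigma> (\<psi> z) w = \<tau> (\<psi> z) w + (1 / \<mu>) *\<^sub>R (unit_wedge (u (\<psi> z)) (v (\<psi> z)) w - unit_wedge (u' (\<psi> z)) (v' (\<psi> z)) w)"
    if z: "z \<in> N" for z w
  proof (rule \<sigma>)
    let ?q = "\<psi> z"
    note s = u(4)[OF N(4)[OF z]] u'(4)[OF N(5)[OF z]] v(4)[OF N(6)[OF z]] v'(4)[OF N(7)[OF z]]
    show "u ?q \<in> fp ?q" "v ?q \<in> fp' ?q" "u' ?q \<in> fm ?q" "v' ?q \<in> fm' ?q"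
      unfolding s by (simp_all add: span_base)
    have "lip (u ?q) (v ?q) \<noteq> 0" "lip (u' ?q) (v' ?q) \<noteq> 0"
      using no[of ?q] unfolding s by (simp_all add: orth_span)
    then show "u ?q \<noteq> 0" "v ?q \<noteq> 0" "u' ?q \<noteq> 0" "v' ?q \<noteq> 0" by (auto simp: lip.zero_left lip.zero_right)
  qed
  have "(\<lambda>w. \<tau>' (\<psi> y) w - \<sigma> (\<psi> y) w) = (\<lambda>_. 0)"
  proof (rule legendre_parallel_wedge_vanishes[OF surf om'(1,4,5) c(1) N(1-3)])
    fix z assume z: "z \<in> N"
    have "\<sigma> (\<psi> z) \<in> wedge_set (fp' (\<psi> z)) (fm' (\<psi> z))"
      using linkD(2)[OF lk] unfolding isotropic_pair_def by blast
    then show "(\<lambda>w. \<tau>' (\<psi> z) w - \<sigma> (\<psi> z) w) \<in> wedge_set (fp' (\<psi> z)) (fm' (\<psi> z))"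
      using wedge_set_diff[OF w(2) _ om'(4,5)] by blast
    fix w
    have zW: "z \<in> W" using z N(2) by blast
    have hp: "((\<lambda>z. unit_wedge (u (\<psi> z)) (v (\<psi> z)) w) has_derivative
       (\<lambda>a. \<mu> *\<^sub>R (\<eta>p' (W, \<psi>) z a w - \<eta>p (W, \<psi>) z a w))) (at z)"
      using z N u(4) v(4) smooth_map_differentiable[OF u(3) c(1) zW] smooth_map_differentiable[OF v(3) c(1) zW]
      by (intro darboux_transform_derivative[OF dt(1) c(1) zW]) auto
    have hm: "((\<lambda>z. unit_wedge (u' (\<psi> z)) (v' (\<psi> z)) w) has_derivative
       (\<lambda>a. \<mu> *\<^sub>R (\<eta>m' (W, \<psi>) z a w - \<eta>m (W, \<psi>) z a w))) (at z)"
      using z N u'(4) v'(4) smooth_map_differentiable[OF u'(3) c(1) zW] smooth_map_differentiable[OF v'(3) c(1) zW]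
      by (intro darboux_transform_derivative[OF dt(2) c(1) zW]) auto
    note t = isotropic_darboux_derivative[OF \<tau> om(6) c(1) zW, of w]
    note t' = isotropic_darboux_derivative[OF \<tau>' om'(6) c(1) zW, of w]
    have "((\<lambda>z. \<tau>' (\<psi> z) w - (\<tau> (\<psi> z) w + (1 / \<mu>) *\<^sub>R (unit_wedge (u (\<psi> z)) (v (\<psi> z)) w - unit_wedge (u' (\<psi> z)) (v' (\<psi> z)) w)))
       has_derivative (\<lambda>_. 0)) (at z)"
      using has_derivative_diff[OF t' has_derivative_add[OF t
            has_derivative_scaleR_right[OF has_derivative_diff[OF hp hm], of "1 / \<mu>"]]] \<mu>
      by (simp add: scaleR_diff_right[symmetric] del: scaleR_diff_right)
    then show "((\<lambda>z. \<tau>' (\<psi> z) w - \<sigma> (\<psi> z) w) has_derivative (\<lambda>_. 0)) (at z)"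
      using N(1) z by (rule has_derivative_transform_within_open) (simp only: \<sigma>N)
  qed
  then have "\<tau>' x = \<sigma> x" unfolding c(3) by (intro ext) (metis eq_iff_diff_eq_0)
  with lk show ?thesis by metis
qed

text \<open>At each point the form has a nonzero value \<open>u \<and> v\<close> with \<open>u\<close> in \<open>f\<close>. It annihilates \<open>c\<close>, and
  linear independence of \<open>u\<close> and \<open>v\<close> then gives \<open>c \<perp> u\<close>.\<close>

lemma const_conserved_perp:
  assumes surf: "smooth_surface A" and iso: "isothermic A f \<eta>" and cc: "const_conserved A \<eta> c"
  shows "c \<in> perp (f p)"
proof -
  obtain W \<psi> y where ch: "(W, \<psi>) \<in> A" "y \<in> W" "\<psi> y = p" "open W" using chartE[OF surf] .
  have "\<forall>(W, \<psi>)\<in>A. \<forall>y\<in>W. \<exists>a w. \<eta> (W, \<psi>) y a w \<noteq> 0"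
    "\<forall>(W, \<psi>)\<in>A. \<forall>y\<in>W. \<forall>a. \<eta> (W, \<psi>) y a \<in> wedge_set (f (\<psi> y)) (perp (f (\<psi> y)))"
    and nl: "null_line (f p)"
    using iso unfolding isothermic_def null_line_bundle_def by blast+
  then obtain a w where a: "\<eta> (W, \<psi>) y a w \<noteq> 0" "\<eta> (W, \<psi>) y a \<in> wedge_set (f p) (perp (f p))"
    using ch(1,2) unfolding ch(3)[symmetric] by fast
  obtain u v where uv: "u \<in> f p" "\<eta> (W, \<psi>) y a = wedge u v" using a(2) by (auto simp: wedge_set_def)
  have "\<forall>t. \<forall>(W, \<psi>)\<in>A. \<forall>y\<in>W. \<forall>a. conn \<eta> t (\<lambda>_. c) (W, \<psi>) y a = 0"
    using cc unfolding const_conserved_def by (rule conjunct2)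
  then have "conn \<eta> 1 (\<lambda>_. c) (W, \<psi>) y a = 0" using ch(1,2) by fast
  then have 0: "lip u c *\<^sub>R v = lip v c *\<^sub>R u" unfolding conn_const uv(2) by (simp add: wedge_def)
  have "lip u c = 0"
  proof (rule ccontr)
    assume nz: "lip u c \<noteq> 0"
    have "(1 / lip u c) *\<^sub>R lip u c *\<^sub>R v = (1 / lip u c) *\<^sub>R lip v c *\<^sub>R u" using 0 by simp
    then have "v = (lip v c / lip u c) *\<^sub>R u" using nz by simp
    then obtain k where "v = k *\<^sub>R u" by blast
    then have "wedge u v w = 0" by (simp add: wedge_def lip_simps)
    with a(1) uv(2) show False by simp
  qed
  moreover have "u \<noteq> 0" using a(1) unfolding uv(2) by (auto simp: wedge_def lip_simps)
  then have "f p = span {u}" using nl uv(1) span_singleton_eq(1) null_lineE by metis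
  ultimately show ?thesis by (auto simp: perp_def span_singleton lip_simps)
qed


section \<open>The discrete surface\<close>

text \<open>Both ends of an edge differ by one step in one coordinate; the smaller value of this coordinate
  is the index of the parameter.\<close>

definition parameter_labeling :: "(nat \<Rightarrow> real) \<Rightarrow> (nat \<Rightarrow> real) \<Rightarrow> vertex \<Rightarrow> vertex \<Rightarrow> real" where
  "parameter_labeling \<alpha> \<beta> i j =
     (if fst i = fst j then \<beta> (min (snd i) (snd j)) else \<alpha> (min (fst i) (fst j)))"

lemma parameter_labeling_simps [simp]:
  "parameter_labeling \<alpha> \<beta> (m, n) (Suc m, n) = \<alpha> m" "parameter_labeling \<alpha> \<beta> (Suc m, n) (m, n) = \<alpha> m"
  "parameter_labeling \<alpha> \<beta> (m, n) (m, Suc n) = \<beta> n" "parameter_labeling \<alpha> \<beta> (m, Suc n) (m, n) = \<beta> n"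
  by (simp_all add: parameter_labeling_def min_def)

lemma adj_cases:
  assumes "adj i j"
  obtains m n where "i = (m, n)" "j = (Suc m, n)" | m n where "i = (Suc m, n)" "j = (m, n)"
    | m n where "i = (m, n)" "j = (m, Suc n)" | m n where "i = (m, Suc n)" "j = (m, n)"
  using assms unfolding adj_def doubleton_eq_iff by blast

lemma edge_labeling_parameters:
  assumes "\<And>m. \<alpha> m \<noteq> 0" "\<And>n. \<beta> n \<noteq> 0"
  shows "edge_labeling (parameter_labeling \<alpha> \<beta>)"
proof -
  have "parameter_labeling \<alpha> \<beta> i j \<noteq> 0 \<and> parameter_labeling \<alpha> \<beta> i j = parameter_labeling \<alpha> \<beta> j i"
    if "adj i j" for i j
    using that by (cases rule: adj_cases) (simp_all add: assms)
  moreover have "\<forall>m n. parameter_labeling \<alpha> \<beta> (m, n) (Suc m, n) = parameter_labeling \<alpha> \<beta> (m, Suc n) (Suc m, Suc n) \<and>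
      parameter_labeling \<alpha> \<beta> (m, n) (m, Suc n) = parameter_labeling \<alpha> \<beta> (Suc m, n) (Suc m, Suc n)"
    by simp
  ultimately show ?thesis unfolding edge_labeling_def by blast
qed

lemma bianchi_latticeD:
  assumes "bianchi_lattice \<alpha> \<beta> f"
  shows "\<not> orth (f m n x) (f (Suc m) n x)" "\<not> orth (f m n x) (f m (Suc n) x)"
    "f (Suc m) (Suc n) x = Gam (f m n x) (f (Suc m) n x) (1 - \<beta> n / \<alpha> m) ` f m (Suc n) x"
    "f (Suc m) (Suc n) x = Gam (f m n x) (f m (Suc n) x) (1 - \<alpha> m / \<beta> n) ` f (Suc m) n x"
  using assms unfolding bianchi_lattice_def by blast+

lemma discrete_isothermic_bianchi:
  fixes f :: "nat \<Rightarrow> nat \<Rightarrow> 'p \<Rightarrow> r42 set"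
  assumes bianchi: "bianchi_lattice \<alpha> \<beta> f" and nl: "\<And>m n. null_line (f m n x)"
    and par: "\<And>m. \<alpha> m \<noteq> 0" "\<And>n. \<beta> n \<noteq> 0" "\<And>m n. \<alpha> m \<noteq> \<beta> n"
  shows "discrete_isothermic (\<lambda>(m, n). f m n x) (parameter_labeling \<alpha> \<beta>)"
proof -
  let ?F = "\<lambda>(m, n). f m n x"
  note b = bianchi_latticeD[OF bianchi]
  have "\<not> orth (?F i) (?F j)" if "adj i j" for i j
    using that b(1)[where x = x] b(2)[where x = x] orth_commute by (cases rule: adj_cases) auto
  moreover have "Gam (f (Suc m) n x) (f (Suc m) (Suc n) x) (1 - t / \<beta> n) \<circ> Gam (f m n x) (f (Suc m) n x) (1 - t / \<alpha> m) =
      Gam (f m (Suc n) x) (f (Suc m) (Suc n) x) (1 - t / \<alpha> m) \<circ> Gam (f m n x) (f m (Suc n) x) (1 - t / \<beta> n)"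
    if "t \<noteq> \<alpha> m" "t \<noteq> \<beta> n" for m n t
    by (rule Gam_permutability[OF nl nl nl b(1) b(2) b(2) b(1) b(3) b(4) par that])
  moreover have "null_line (?F i)" for i using nl by (cases i) simp
  ultimately show ?thesis
    unfolding discrete_isothermic_def Let_def dconn_def
    using edge_labeling_parameters[OF par(1,2)] by simp
qed

lemma discrete_const_conserved_perp:
  assumes F: "\<And>i. null_line (F i)" "\<And>i j. adj i j \<Longrightarrow> \<not> orth (F i) (F j)" "\<And>i. c \<in> perp (F i)"
    and c: "c \<noteq> 0" and lab: "edge_labeling lab"
  shows "discrete_const_conserved F lab c"
  unfolding discrete_const_conserved_def dconn_def
proof (intro conjI allI impI c)
  fix i j t assume "adj i j" "t \<noteq> lab i j"
  moreover from this have "lab i j \<noteq> 0" using lab unfolding edge_labeling_def by blast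
  ultimately show "Gam (F i) (F j) (1 - t / lab i j) c = c"
    by (intro Gam_fixes F) auto
qed

text \<open>The fourth corner of a Bianchi quadrilateral lies in the span of the other three.\<close>

lemma perp_bianchi_lattice:
  assumes bianchi: "bianchi_lattice \<alpha> \<beta> f" and nl: "\<And>m n. null_line (f m n x)"
    and par: "\<And>m. \<alpha> m \<noteq> 0" "\<And>m n. \<alpha> m \<noteq> \<beta> n"
    and axes: "\<And>m. c \<in> perp (f m 0 x)" "\<And>n. c \<in> perp (f 0 n x)"
  shows "c \<in> perp (f m n x)"
proof (induction n arbitrary: m)
  case (Suc n)
  note row = Suc
  show ?case
  proof (induction m)
    case (Suc m)
    note b = bianchi_latticeD[OF bianchi]
    have "1 - \<beta> n / \<alpha> m \<noteq> 0" using par[of m] by auto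
    then show ?case unfolding b(3) by (intro perp_Gam_image nl b(1) row Suc)
  qed (rule axes)
qed (rule axes)

theorem corollary3p6:
  fixes A :: "('p::{t2_space,second_countable_topology}) chart set"
    and fp fm :: "nat \<Rightarrow> nat \<Rightarrow> 'p \<Rightarrow> r42 set"
    and \<eta>p \<eta>m :: "nat \<Rightarrow> nat \<Rightarrow> 'p form"
    and cp cm :: r42
    and \<alpha> \<beta> :: "nat \<Rightarrow> real"
    and \<Lambda> :: "nat \<Rightarrow> nat \<Rightarrow> 'p \<Rightarrow> r42 set"
  assumes surface: "smooth_surface A" "simply_connected (UNIV :: 'p set)"
    and initial: "linear_weingarten A (fp 0 0) (\<eta>p 0 0) (fm 0 0) (\<eta>m 0 0) cp cm"
    and axis1: "\<And>m. lie_darboux_keeping_lw A cp cm (\<alpha> m)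
           (fp m 0) (\<eta>p m 0) (fm m 0) (\<eta>m m 0)
           (fp (Suc m) 0) (\<eta>p (Suc m) 0) (fm (Suc m) 0) (\<eta>m (Suc m) 0)"
    and axis2: "\<And>n. lie_darboux_keeping_lw A cp cm (\<beta> n)
           (fp 0 n) (\<eta>p 0 n) (fm 0 n) (\<eta>m 0 n)
           (fp 0 (Suc n)) (\<eta>p 0 (Suc n)) (fm 0 (Suc n)) (\<eta>m 0 (Suc n))"
    and parameters: "\<And>m n. \<alpha> m \<noteq> \<beta> n"
    and bianchi: "bianchi_lattice \<alpha> \<beta> fp" "bianchi_lattice \<alpha> \<beta> fm"
    and span: "\<And>m n x. \<Lambda> m n x = lsum (fp m n x) (fm m n x)"
  shows "\<forall>x. discrete_linear_weingarten (\<lambda>(m, n). \<Lambda> m n x)"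
proof
  fix x
  have ld: "lie_darboux A (\<alpha> m) (fp m 0) (\<eta>p m 0) (fm m 0) (\<eta>m m 0)
           (fp (Suc m) 0) (\<eta>p (Suc m) 0) (fm (Suc m) 0) (\<eta>m (Suc m) 0)"
    "lie_darboux A (\<beta> n) (fp 0 n) (\<eta>p 0 n) (fm 0 n) (\<eta>m 0 n)
           (fp 0 (Suc n)) (\<eta>p 0 (Suc n)) (fm 0 (Suc n)) (\<eta>m 0 (Suc n))"
    and perp_Suc: "cp \<in> perp (fp (Suc m) 0 x)" "cp \<in> perp (fp 0 (Suc n) x)"
      "cm \<in> perp (fm (Suc m) 0 x)" "cm \<in> perp (fm 0 (Suc n) x)" for m n
    using axis1[of m] axis2[of n] unfolding lie_darboux_keeping_lw_def by blast+
  have om: "omega_surface A (fp m 0) (\<eta>p m 0) (fm m 0) (\<eta>m m 0)"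
    "omega_surface A (fp 0 n) (\<eta>p 0 n) (fm 0 n) (\<eta>m 0 n)" for m n
    by (rule lie_darbouxD(1)[OF ld(1)], rule lie_darbouxD(1)[OF ld(2)])
  have par: "\<alpha> m \<noteq> 0" "\<beta> n \<noteq> 0" for m n
    by (rule lie_darbouxD(2)[OF ld(1)], rule lie_darbouxD(2)[OF ld(2)])
  have cc: "const_conserved A (\<eta>p 0 0) cp" "const_conserved A (\<eta>m 0 0) cm"
    using initial unfolding linear_weingarten_def by blast+
  then have c0: "cp \<noteq> 0" "cm \<noteq> 0" unfolding const_conserved_def by blast+

  have "\<forall>m. \<exists>T. isotropic_darboux A (fp m 0) (\<eta>p m 0) (fm m 0) (\<eta>m m 0) T"
    using om(1) unfolding omega_surface_def by blast
  then have "\<exists>S. \<forall>m. isotropic_darboux A (fp m 0) (\<eta>p m 0) (fm m 0) (\<eta>m m 0) (S m)" by (rule choice)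
  then obtain S where S: "\<And>m. isotropic_darboux A (fp m 0) (\<eta>p m 0) (fm m 0) (\<eta>m m 0) (S m)" by blast
  have "\<forall>n. \<exists>T. isotropic_darboux A (fp 0 n) (\<eta>p 0 n) (fm 0 n) (\<eta>m 0 n) T"
    using om(2) unfolding omega_surface_def by blast
  then have "\<exists>R. \<forall>n. isotropic_darboux A (fp 0 n) (\<eta>p 0 n) (fm 0 n) (\<eta>m 0 n) (R n)" by (rule choice)
  then obtain R where R: "\<And>n. isotropic_darboux A (fp 0 n) (\<eta>p 0 n) (fm 0 n) (\<eta>m 0 n) (R n)" by blast

  note b = bianchi_latticeD[OF bianchi(1)] bianchi_latticeD[OF bianchi(2)]
  obtain T where T:
    "\<And>m n. link (\<alpha> m) (fp m n x) (fm m n x) (T m n) (fp (Suc m) n x) (fm (Suc m) n x) (T (Suc m) n)"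
    "\<And>m n. link (\<beta> n) (fp m n x) (fm m n x) (T m n) (fp m (Suc n) x) (fm m (Suc n) x) (T m (Suc n))"
  proof (rule lattice_extension[where S = "\<lambda>m. S m x" and R = "\<lambda>n. R n x"
      and H = "\<lambda>m n \<tau> \<sigma>. link (\<alpha> m) (fp m n x) (fm m n x) \<tau> (fp (Suc m) n x) (fm (Suc m) n x) \<sigma>"
      and V = "\<lambda>m n \<tau> \<sigma>. link (\<beta> n) (fp m n x) (fm m n x) \<tau> (fp m (Suc n) x) (fm m (Suc n) x) \<sigma>"])
    show "link (\<alpha> m) (fp m 0 x) (fm m 0 x) (S m x) (fp (Suc m) 0 x) (fm (Suc m) 0 x) (S (Suc m) x)" for m
      by (rule lie_darboux_link[OF surface(1) ld(1) om(1) S S])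
    show "link (\<beta> n) (fp 0 n x) (fm 0 n x) (R n x) (fp 0 (Suc n) x) (fm 0 (Suc n) x) (R (Suc n) x)" for n
      by (rule lie_darboux_link[OF surface(1) ld(2) om(2) R R])
    show "S 0 x = R 0 x" by (rule isotropic_darboux_unique[OF surface(1) om(1) S R])
    show "\<exists>d. link (\<beta> n) (fp (Suc m) n x) (fm (Suc m) n x) \<tau>j (fp (Suc m) (Suc n) x) (fm (Suc m) (Suc n) x) d \<and>
        link (\<alpha> m) (fp m (Suc n) x) (fm m (Suc n) x) \<tau>l (fp (Suc m) (Suc n) x) (fm (Suc m) (Suc n) x) d"
      if "link (\<alpha> m) (fp m n x) (fm m n x) \<tau>i (fp (Suc m) n x) (fm (Suc m) n x) \<tau>j"
        "link (\<beta> n) (fp m n x) (fm m n x) \<tau>i (fp m (Suc n) x) (fm m (Suc n) x) \<tau>l" for m n \<tau>i \<tau>j \<tau>l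
      by (intro link_quadrilateral[OF that] par parameters b)
  qed (rule that)
  have pair: "isotropic_pair (fp m n x) (fm m n x) (T m n)" for m n by (rule linkD(1)[OF T(1)])
  have nl: "null_line (fp m n x)" "null_line (fm m n x)" for m n
    using pair[of m n] unfolding isotropic_pair_def by blast+

  let ?Fp = "\<lambda>(m, n). fp m n x" and ?Fm = "\<lambda>(m, n). fm m n x" and ?lab = "parameter_labeling \<alpha> \<beta>"
  have iso: "discrete_isothermic ?Fp ?lab" "discrete_isothermic ?Fm ?lab"
    by (rule discrete_isothermic_bianchi[OF bianchi(1) nl(1) par parameters],
        rule discrete_isothermic_bianchi[OF bianchi(2) nl(2) par parameters])
  have gauge: "dconn ?Fm ?lab t j i = exp_tau t (case_prod T j) \<circ> dconn ?Fp ?lab t j i \<circ> exp_tau (- t) (case_prod T i)"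
    if "adj i j" "t \<noteq> ?lab i j" for i j t
    using that linkD(6)[OF T(1)] linkD(6)[OF T(2)] link_reverse[OF T(1) _ par(1)] link_reverse[OF T(2) _ par(2)]
    unfolding dconn_def by (cases rule: adj_cases) (simp_all only: parameter_labeling_simps prod.case)
  have wedge: "case_prod T i \<in> wedge_set (?Fp i) (?Fm i)" for i
    using pair unfolding isotropic_pair_def by (cases i) simp
  have "discrete_isotropic_darboux ?Fp ?Fm ?lab"
    unfolding discrete_isotropic_darboux_def using iso wedge gauge by blast
  moreover have "(case i of (m, n) \<Rightarrow> \<Lambda> m n x) = lsum (?Fp i) (?Fm i) \<and> null_plane (case i of (m, n) \<Rightarrow> \<Lambda> m n x)" for i
    using null_plane_isotropic_pair[OF pair] by (cases i) (simp add: span)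
  ultimately have omega: "discrete_omega_surface (\<lambda>(m, n). \<Lambda> m n x) ?Fp ?Fm ?lab"
    unfolding discrete_omega_surface_def by blast

  have perp0: "cp \<in> perp (fp 0 0 x)" "cm \<in> perp (fm 0 0 x)"
    by (rule const_conserved_perp[OF surface(1) omega_surfaceD(2)[OF om(1)] cc(1)],
        rule const_conserved_perp[OF surface(1) omega_surfaceD(3)[OF om(1)] cc(2)])
  have axes: "cp \<in> perp (fp k 0 x)" "cp \<in> perp (fp 0 k x)" "cm \<in> perp (fm k 0 x)" "cm \<in> perp (fm 0 k x)" for k
    using perp0 perp_Suc by (cases k; simp)+
  have perp: "cp \<in> perp (fp m n x)" "cm \<in> perp (fm m n x)" for m n
    by (rule perp_bianchi_lattice[OF bianchi(1) nl(1) par(1) parameters axes(1,2)],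
        rule perp_bianchi_lattice[OF bianchi(2) nl(2) par(1) parameters axes(3,4)])
  have "discrete_const_conserved ?Fp ?lab cp" "discrete_const_conserved ?Fm ?lab cm"
    using iso perp c0 edge_labeling_parameters[OF par]
    by (intro discrete_const_conserved_perp; auto simp: discrete_isothermic_def)+
  with omega show "discrete_linear_weingarten (\<lambda>(m, n). \<Lambda> m n x)"
    unfolding discrete_linear_weingarten_def by blast
qed

end
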